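(* Let $(x_n)_n$ be a frame or an outer frame for a Hilbert $C^*$-module $X$ over a $C^*$-algebra $\mathsf{A}$, with analysis operator $U$ and optimal frame bounds $A$ and $B$. Let $V_0=\frac{\sqrt{A}+\sqrt{B}}{2}\,U(U^*U)^{-\frac12}$. Then $V_0$ is the analysis operator of a $\left(\frac{\sqrt{A}+\sqrt{B}}{2}\right)^2$-tight frame or outer frame for $X$ for which $$\|U-V_0\|=\frac{\sqrt{B}-\sqrt{A}}{2}.$$ If $(y_n)_n$ is any tight frame or tight outer frame for $X$ with analysis operator $V$, then $$\|U-V\|\ge\frac{\sqrt{B}-\sqrt{A}}{2}.$$
   Context: $\mathsf{A}$ is an arbitrary $C^*$-algebra (not necessarily unital) with multiplier algebra $M(\mathsf{A})$. Hilbert $\mathsf{A}$-modules are right modules with inner product $\mathsf{A}$-linear in the second variable; they are not assumed full. $\mathbb{B}(X,Y)$ denotes the adjointable operators from $X$ to $Y$. $\ell^2(\mathsf{A})$ is the Hilbert $\mathsf{A}$-module of sequences $(a_n)_n$ in $\mathsf{A}$ with $\sum_n a_n^*a_n$ norm convergent, with inner product $\langle (a_n)_n,(b_n)_n\rangle=\sum_n a_n^*b_n$. $M(X)$ denotes the multiplier module of $X$: $M(X)=\mathbb{B}(\mathsf{A},X)$, a Hilbert $M(\mathsf{A})$-module with $\langle v,w\rangle=v^*w\in\mathbb{B}(\mathsf{A})=M(\mathsf{A})$, containing $X$ via $x\mapsto(a\mapsto xa)$, and $M(X)\mathsf{A}=X$; thus $\langle v,x\rangle\in\mathsf{A}$ for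 $v\in M(X)$, $x\in X$. All sequences are infinite, indexed by $\mathbb{N}$ (finite frames are extended by zeros). A sequence $(x_n)_n$ in $X$ is a frame for $X$ if there are constants $A,B>0$ with $A\langle x,x\rangle\le\sum_{n=1}^\infty\langle x,x_n\rangle\langle x_n,x\rangle\le B\langle x,x\rangle$ for all $x\in X$, the series converging in norm. A sequence $(x_n)_n$ in $M(X)$ is an outer frame for $X$ if $x_n\in M(X)\setminus X$ for at least one $n$ and the same inequalities hold for all $x\in X$ (with norm convergence in $\mathsf{A}$) for some $A,B>0$. An (outer) frame is $c$-tight, $c>0$, if one can take $A=B=c$, and tight if it is $c$-tight for some $c>0$; equivalently its analysis operator $V$ satisfies $V^*V=cI$. The optimal frame bounds are the largest possible $A$ and the smallest possible $B$. The analysis operator of a frame or outer frame $(x_n)_n$ is $U\in\mathbb{B}(X,\ell^2(\mathsf{A}))$, $Ux=(\langle x_n,x\rangle)_n$; $U^*U$ is invertible in $\mathbb{B}(X)$. *)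

theory Defs
  imports "HOL-Analysis.Analysis"
begin

class complex_banach = banach +
  fixes scaleC :: "complex \<Rightarrow> 'a \<Rightarrow> 'a" (infixr "*\<^sub>C" 75)
  assumes scaleC_add_right: "c *\<^sub>C (x + y) = c *\<^sub>C x + c *\<^sub>C y"
    and scaleC_add_left: "(c + d) *\<^sub>C x = c *\<^sub>C x + d *\<^sub>C x"
    and scaleC_scaleC: "c *\<^sub>C (d *\<^sub>C x) = (c * d) *\<^sub>C x"
    and scaleR_scaleC: "r *\<^sub>R x = complex_of_real r *\<^sub>C x"
    and norm_scaleC: "norm (c *\<^sub>C x) = cmod c * norm x"

text \<open>The superclass \<^class>\<open>real_normed_algebra\<close> does not require a unit.\<close>

class cstar_algebra = complex_banach + real_normed_algebra +
  fixes star :: "'a \<Rightarrow> 'a"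
  assumes mult_scaleC_left: "(c *\<^sub>C a) * b = c *\<^sub>C (a * b)"
    and mult_scaleC_right: "a * (c *\<^sub>C b) = c *\<^sub>C (a * b)"
    and star_star: "star (star a) = a"
    and star_add: "star (a + b) = star a + star b"
    and star_scaleC: "star (c *\<^sub>C a) = cnj c *\<^sub>C star a"
    and star_mult: "star (a * b) = star b * star a"
    and norm_star_mult: "norm (star a * a) = (norm a)\<^sup>2"

definition positive :: "'a::cstar_algebra \<Rightarrow> bool" where
  "positive a \<longleftrightarrow> (\<exists>b. a = star b * b)"

definition cstar_le :: "'a::cstar_algebra \<Rightarrow> 'a \<Rightarrow> bool" (infix "\<sqsubseteq>" 50) where
  "a \<sqsubseteq> b \<longleftrightarrow> positive (b - a)"

text \<open>A Hilbert module is carried by a whole type; completeness with respect to the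
  norm coming from the inner product is \<open>norm_ip\<close> together with the class constraint.\<close>

locale hilbert_module =
  fixes act :: "'x::complex_banach \<Rightarrow> 'a::cstar_algebra \<Rightarrow> 'x"
    and ip :: "'x \<Rightarrow> 'x \<Rightarrow> 'a"
  assumes act_add_left: "act (x + y) a = act x a + act y a"
    and act_add_right: "act x (a + b) = act x a + act x b"
    and act_act: "act (act x a) b = act x (a * b)"
    and act_scaleC_left: "act (c *\<^sub>C x) a = c *\<^sub>C act x a"
    and act_scaleC_right: "act x (c *\<^sub>C a) = c *\<^sub>C act x a"
    and ip_add: "ip x (y + z) = ip x y + ip x z"
    and ip_scaleC: "ip x (c *\<^sub>C y) = c *\<^sub>C ip x y"
    and ip_act: "ip x (act y a) = ip x y * a"
    and ip_star: "star (ip x y) = ip y x"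
    and ip_positive: "positive (ip x x)"
    and ip_definite: "ip x x = 0 \<Longrightarrow> x = 0"
    and norm_ip: "norm x = sqrt (norm (ip x x))"

text \<open>The carriers \<open>S\<close>, \<open>T\<close> are explicit because the standard module
  of sequences below is a proper subset of its type. Maps with an adjoint are automatically
  module maps and bounded, so neither is required separately.\<close>

definition is_adjoint ::
  "'x set \<Rightarrow> ('x \<Rightarrow> 'x \<Rightarrow> 'a) \<Rightarrow> 'y set \<Rightarrow> ('y \<Rightarrow> 'y \<Rightarrow> 'a) \<Rightarrow> ('x \<Rightarrow> 'y) \<Rightarrow> ('y \<Rightarrow> 'x) \<Rightarrow> bool"
  where "is_adjoint S ipS T ipT f g \<longleftrightarrow>
    f \<in> S \<rightarrow> T \<and> g \<in> T \<rightarrow> S \<and> (\<forall>x\<in>S. \<forall>y\<in>T. ipT (f x) y = ipS x (g y))"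

definition adjointable ::
  "'x set \<Rightarrow> ('x \<Rightarrow> 'x \<Rightarrow> 'a) \<Rightarrow> 'y set \<Rightarrow> ('y \<Rightarrow> 'y \<Rightarrow> 'a) \<Rightarrow> ('x \<Rightarrow> 'y) \<Rightarrow> bool"
  where "adjointable S ipS T ipT f \<longleftrightarrow> (\<exists>g. is_adjoint S ipS T ipT f g)"

definition adj ::
  "'x set \<Rightarrow> ('x \<Rightarrow> 'x \<Rightarrow> 'a) \<Rightarrow> 'y set \<Rightarrow> ('y \<Rightarrow> 'y \<Rightarrow> 'a) \<Rightarrow> ('x \<Rightarrow> 'y) \<Rightarrow> 'y \<Rightarrow> 'x"
  where "adj S ipS T ipT f = (SOME g. is_adjoint S ipS T ipT f g)"

text \<open>Positivity, square roots and inverses in the C*-algebra of adjointable operators on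
  a module. For positive invertible \<open>P\<close>, \<open>op_inv_sqrt ip P\<close> is the operator \<open>P\<close> to the
  power -1/2: the inverse of the unique positive square root.\<close>

definition positive_op :: "('x \<Rightarrow> 'x \<Rightarrow> 'a) \<Rightarrow> ('x \<Rightarrow> 'x) \<Rightarrow> bool" where
  "positive_op ip P \<longleftrightarrow> (\<exists>R. adjointable UNIV ip UNIV ip R \<and> P = adj UNIV ip UNIV ip R \<circ> R)"

definition op_sqrt :: "('x \<Rightarrow> 'x \<Rightarrow> 'a) \<Rightarrow> ('x \<Rightarrow> 'x) \<Rightarrow> 'x \<Rightarrow> 'x" where
  "op_sqrt ip P = (THE Q. positive_op ip Q \<and> Q \<circ> Q = P)"

definition op_inv_sqrt :: "('x \<Rightarrow> 'x \<Rightarrow> 'a) \<Rightarrow> ('x \<Rightarrow> 'x) \<Rightarrow> 'x \<Rightarrow> 'x" where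
  "op_inv_sqrt ip P = inv (op_sqrt ip P)"

definition l2 :: "(nat \<Rightarrow> 'a::cstar_algebra) set" where
  "l2 = {a. summable (\<lambda>n. star (a n) * a n)}"

definition l2_ip :: "(nat \<Rightarrow> 'a::cstar_algebra) \<Rightarrow> (nat \<Rightarrow> 'a) \<Rightarrow> 'a" where
  "l2_ip a b = (\<Sum>n. star (a n) * b n)"

definition l2_norm :: "(nat \<Rightarrow> 'a::cstar_algebra) \<Rightarrow> real" where
  "l2_norm a = sqrt (norm (l2_ip a a))"

definition op_norm :: "('x::complex_banach \<Rightarrow> nat \<Rightarrow> 'a::cstar_algebra) \<Rightarrow> real" where
  "op_norm T = (SUP x\<in>{x. norm x \<le> 1}. l2_norm (T x))"

text \<open>This makes the algebra a Hilbert module over itself.\<close>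

definition alg_ip :: "'a::cstar_algebra \<Rightarrow> 'a \<Rightarrow> 'a" where
  "alg_ip a b = star a * b"

definition multiplier_module :: "('x \<Rightarrow> 'x \<Rightarrow> 'a::cstar_algebra) \<Rightarrow> ('a \<Rightarrow> 'x) set" where
  "multiplier_module ip = {v. adjointable UNIV alg_ip UNIV ip v}"

text \<open>An element \<open>x\<close> of the module is identified with the multiplier \<open>embed act x\<close>.\<close>

definition embed :: "('x \<Rightarrow> 'a \<Rightarrow> 'x) \<Rightarrow> 'x \<Rightarrow> 'a \<Rightarrow> 'x" where
  "embed act x = (\<lambda>a. act x a)"

text \<open>The inner product of a multiplier \<open>v\<close> with a module element \<open>x\<close>. In the
  multiplier module it is the composition of the adjoint of \<open>v\<close> with \<open>embed act x\<close>, and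
  by \<open>adj_comp_embed\<close> below that is left multiplication by \<open>mult_ip ip v x\<close>.\<close>

definition mult_ip :: "('x \<Rightarrow> 'x \<Rightarrow> 'a::cstar_algebra) \<Rightarrow> ('a \<Rightarrow> 'x) \<Rightarrow> 'x \<Rightarrow> 'a" where
  "mult_ip ip v x = adj UNIV alg_ip UNIV ip v x"

lemma alg_ip_nondegenerate:
  fixes u w :: "'a::cstar_algebra"
  assumes "\<And>a. alg_ip a u = alg_ip a w"
  shows "u = w"
proof -
  have "alg_ip (u - w) (u - w) = 0"
    using assms[of "u - w"] by (simp add: alg_ip_def algebra_simps)
  then have "(norm (u - w))\<^sup>2 = 0"
    by (metis alg_ip_def norm_star_mult norm_zero)
  then show ?thesis by simp
qed

lemma mult_ip_adjoint:
  assumes "v \<in> multiplier_module ip"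
  shows "ip (v a) x = star a * mult_ip ip v x"
proof -
  have "is_adjoint UNIV alg_ip UNIV ip v (adj UNIV alg_ip UNIV ip v)"
    using assms unfolding multiplier_module_def adjointable_def adj_def
    by (simp add: someI_ex)
  then show ?thesis by (simp add: is_adjoint_def mult_ip_def alg_ip_def)
qed

context hilbert_module
begin

lemma ip_act_left: "ip (act x a) y = star a * ip x y"
  by (metis ip_act ip_star star_mult)

lemma embed_in_multiplier_module: "embed act x \<in> multiplier_module ip"
  by (auto simp: multiplier_module_def adjointable_def is_adjoint_def embed_def alg_ip_def
      ip_act_left intro!: exI[of _ "ip x"])

lemma mult_ip_embed: "mult_ip ip (embed act x) y = ip x y"
  by (rule alg_ip_nondegenerate)
    (metis alg_ip_def embed_def embed_in_multiplier_module ip_act_left mult_ip_adjoint)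

lemma adj_comp_embed:
  assumes "v \<in> multiplier_module ip"
  shows "adj UNIV alg_ip UNIV ip v \<circ> embed act x = (\<lambda>a. mult_ip ip v x * a)"
proof
  fix a
  have "alg_ip b (mult_ip ip v (act x a)) = alg_ip b (mult_ip ip v x * a)" for b
    using mult_ip_adjoint[OF assms, of b] by (metis alg_ip_def ip_act mult.assoc)
  then have "mult_ip ip v (act x a) = mult_ip ip v x * a"
    by (rule alg_ip_nondegenerate)
  then show "(adj UNIV alg_ip UNIV ip v \<circ> embed act x) a = mult_ip ip v x * a"
    by (simp add: mult_ip_def embed_def)
qed

end

text \<open>Both kinds of frame are sequences of multipliers. For a frame, whose members are
  embedded module elements, \<open>mult_ip\<close> is the inner product of the module by \<open>mult_ip_embed\<close>.\<close>

definition frame_bounds ::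
  "('x \<Rightarrow> 'x \<Rightarrow> 'a::cstar_algebra) \<Rightarrow> (nat \<Rightarrow> 'a \<Rightarrow> 'x) \<Rightarrow> real \<Rightarrow> real \<Rightarrow> bool"
  where "frame_bounds ip v A B \<longleftrightarrow> 0 < A \<and> 0 < B \<and>
    (\<forall>x. summable (\<lambda>n. star (mult_ip ip (v n) x) * mult_ip ip (v n) x) \<and>
      A *\<^sub>R ip x x \<sqsubseteq> (\<Sum>n. star (mult_ip ip (v n) x) * mult_ip ip (v n) x) \<and>
      (\<Sum>n. star (mult_ip ip (v n) x) * mult_ip ip (v n) x) \<sqsubseteq> B *\<^sub>R ip x x)"

definition frame ::
  "('x \<Rightarrow> 'a \<Rightarrow> 'x) \<Rightarrow> ('x \<Rightarrow> 'x \<Rightarrow> 'a::cstar_algebra) \<Rightarrow> (nat \<Rightarrow> 'a \<Rightarrow> 'x) \<Rightarrow> bool"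
  where "frame act ip v \<longleftrightarrow>
    (\<forall>n. v n \<in> range (embed act)) \<and> (\<exists>A B. frame_bounds ip v A B)"

definition outer_frame ::
  "('x \<Rightarrow> 'a \<Rightarrow> 'x) \<Rightarrow> ('x \<Rightarrow> 'x \<Rightarrow> 'a::cstar_algebra) \<Rightarrow> (nat \<Rightarrow> 'a \<Rightarrow> 'x) \<Rightarrow> bool"
  where "outer_frame act ip v \<longleftrightarrow>
    (\<forall>n. v n \<in> multiplier_module ip) \<and> (\<exists>n. v n \<notin> range (embed act)) \<and>
    (\<exists>A B. frame_bounds ip v A B)"

definition tight ::
  "('x \<Rightarrow> 'x \<Rightarrow> 'a::cstar_algebra) \<Rightarrow> real \<Rightarrow> (nat \<Rightarrow> 'a \<Rightarrow> 'x) \<Rightarrow> bool"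
  where "tight ip c v \<longleftrightarrow> frame_bounds ip v c c"

text \<open>Over the zero module no optimal bounds exist.\<close>

definition optimal_frame_bounds ::
  "('x \<Rightarrow> 'x \<Rightarrow> 'a::cstar_algebra) \<Rightarrow> (nat \<Rightarrow> 'a \<Rightarrow> 'x) \<Rightarrow> real \<Rightarrow> real \<Rightarrow> bool"
  where "optimal_frame_bounds ip v A B \<longleftrightarrow> frame_bounds ip v A B \<and>
    (\<forall>A' B'. frame_bounds ip v A' B' \<longrightarrow> A' \<le> A \<and> B \<le> B')"

definition analysis ::
  "('x \<Rightarrow> 'x \<Rightarrow> 'a::cstar_algebra) \<Rightarrow> (nat \<Rightarrow> 'a \<Rightarrow> 'x) \<Rightarrow> 'x \<Rightarrow> nat \<Rightarrow> 'a"
  where "analysis ip v x = (\<lambda>n. mult_ip ip (v n) x)"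

end

theory Submission
  imports Defs
begin

text \<open>Let \<open>P = U\<^sup>* U\<close> and \<open>S = P\<^sup>1\<^sup>/\<^sup>2\<close>. Since \<open>U S\<^sup>-\<^sup>1\<close> is isometric, \<open>\<parallel>U - V\<^sub>0\<parallel> = \<parallel>S - c\<parallel>\<close>, and this is at most
  \<open>(\<surd>B - \<surd>A) / 2\<close> because \<open>\<surd>A \<le> S \<le> \<surd>B\<close>. Conversely, if \<open>V\<close> is the analysis operator of a
  \<open>c'\<close>-tight frame and \<open>\<delta> = \<parallel>U - V\<parallel>\<close>, then \<open>\<parallel>V x\<parallel> = \<surd>c' \<parallel>x\<parallel>\<close> gives
  \<open>(\<surd>c' - \<delta>) \<parallel>x\<parallel> \<le> \<parallel>U x\<parallel> \<le> (\<surd>c' + \<delta>) \<parallel>x\<parallel>\<close>, and optimality of the bounds gives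
  \<open>\<surd>B \<le> \<surd>c' + \<delta>\<close> and \<open>\<surd>c' - \<delta> \<le> \<surd>A\<close>, hence \<open>\<surd>B - \<surd>A \<le> 2 \<delta>\<close>. Applied to \<open>V\<^sub>0\<close> itself this
  also yields the equality.

  Positivity is handled without spectral theory: \<open>h\<close> is positive when it is self-adjoint with
  \<open>\<parallel>t - h\<parallel> \<le> t\<close> for some \<open>t \<ge> 0\<close>, and square roots come from the iteration
  \<open>Y\<^sub>n\<^sub>+\<^sub>1 = (T + Y\<^sub>n\<^sup>2) / 2\<close>.\<close>

section \<open>Square roots in Banach algebras\<close>

primrec sqrt_iter :: "'e::{banach,real_normed_algebra} \<Rightarrow> nat \<Rightarrow> 'e" where
  "sqrt_iter T 0 = 0"
| "sqrt_iter T (Suc n) = (1/2) *\<^sub>R (T + sqrt_iter T n * sqrt_iter T n)"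

text \<open>For \<open>\<parallel>T\<parallel> \<le> 1\<close> the limit exists and is \<open>1 - \<surd>(1 - T)\<close>, but no unit is needed to describe it.\<close>

definition sqrt_fix :: "'e::{banach,real_normed_algebra} \<Rightarrow> 'e" where
  "sqrt_fix T = lim (sqrt_iter T)"

text \<open>The map sending \<open>z\<close> to \<open>(t + z * z) / 2\<close> is increasing for
  nonnegative \<open>z\<close>, and the last hypothesis says that it does not raise
  \<open>y\<close>; so the iteration, starting at \<open>0\<close>, never passes
  \<open>y\<close>.\<close>

lemma sqrt_iter_real_bounds:
  fixes t y :: real
  assumes "0 \<le> t" "0 \<le> y" "t + y\<^sup>2 \<le> 2 * y"
  shows "0 \<le> sqrt_iter t n \<and> sqrt_iter t n \<le> y"
proof (induction n)
  case (Suc n)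
  then have "sqrt_iter t n * sqrt_iter t n \<le> y\<^sup>2"
    unfolding power2_eq_square using assms by (intro mult_mono) auto
  then show ?case using assms Suc by auto
qed (use assms in auto)

lemma sqrt_iter_norm_le: "norm (sqrt_iter T n) \<le> sqrt_iter (norm T) n"
proof (induction n)
  case (Suc n)
  have "0 \<le> sqrt_iter (norm T) n"
    using Suc norm_ge_zero by (rule order_trans[rotated])
  then have "norm (sqrt_iter T n * sqrt_iter T n) \<le> sqrt_iter (norm T) n * sqrt_iter (norm T) n"
    using Suc by (intro order_trans[OF norm_mult_ineq] mult_mono) auto
  then show ?case
    using norm_triangle_ineq[of T "sqrt_iter T n * sqrt_iter T n"] by simp
qed simp

text \<open>The splitting \<open>u * u - v * v = u * (u - v) + (u - v) * v\<close> is valid without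
  commutativity, and the same splitting for the real majorants \<open>p\<close>, \<open>q\<close>
  sums exactly to \<open>p * p - q * q\<close>.\<close>

lemma sqrt_iter_diff_le:
  "norm (sqrt_iter T (Suc n) - sqrt_iter T n) \<le> sqrt_iter (norm T) (Suc n) - sqrt_iter (norm T) n"
proof (induction n)
  case (Suc n)
  define u v where "u = sqrt_iter T (Suc n)" and "v = sqrt_iter T n"
  define p q where "p = sqrt_iter (norm T) (Suc n)" and "q = sqrt_iter (norm T) n"
  have b: "norm u \<le> p" "norm v \<le> q" "norm (u - v) \<le> p - q"
    unfolding u_def v_def p_def q_def by (rule sqrt_iter_norm_le sqrt_iter_norm_le Suc)+
  then have pos: "0 \<le> p" "0 \<le> q" "0 \<le> p - q"
    using norm_ge_zero[of u] norm_ge_zero[of v] norm_ge_zero[of "u - v"] by linarith+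
  have "u * u - v * v = u * (u - v) + (u - v) * v"
    by (simp add: algebra_simps)
  then have "norm (u * u - v * v) \<le> norm (u * (u - v)) + norm ((u - v) * v)"
    by (metis norm_triangle_ineq)
  also have "\<dots> \<le> norm u * norm (u - v) + norm (u - v) * norm v"
    by (intro add_mono norm_mult_ineq)
  also have "\<dots> \<le> p * (p - q) + (p - q) * q"
    using b pos by (intro add_mono mult_mono) auto
  finally have "norm (u * u - v * v) \<le> p * p - q * q"
    by (simp add: algebra_simps)
  moreover have "sqrt_iter T (Suc (Suc n)) - u = (1/2) *\<^sub>R (u * u - v * v)"
    unfolding sqrt_iter.simps(2)[of _ "Suc n"] u_def[symmetric]
    unfolding u_def v_def sqrt_iter.simps(2) by (simp add: scaleR_diff_right scaleR_add_right)
  moreover have "sqrt_iter (norm T) (Suc (Suc n)) - p = (p * p - q * q) / 2"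
    unfolding sqrt_iter.simps(2)[of _ "Suc n"] p_def[symmetric]
    unfolding p_def q_def sqrt_iter.simps(2) by (simp add: field_simps)
  ultimately show ?case unfolding u_def[symmetric] p_def[symmetric] by simp
qed simp

text \<open>The real iteration for \<open>norm T\<close> is increasing and bounded by
  \<open>1\<close>, so its increments are summable. They dominate the increments of
  \<open>sqrt_iter T\<close>, which therefore form an absolutely convergent series.\<close>

lemma sqrt_iter_tendsto:
  fixes T :: "'e::{banach,real_normed_algebra}"
  assumes "norm T \<le> 1"
  shows "sqrt_iter T \<longlonglongrightarrow> sqrt_fix T"
proof -
  let ?s = "sqrt_iter (norm T)"
  have "incseq ?s"
    by (intro incseq_SucI) (use order_trans[OF norm_ge_zero sqrt_iter_diff_le[of T]] in simp)
  moreover have "?s n \<le> 1" for n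
    using sqrt_iter_real_bounds[of "norm T" 1 n] assms by simp
  ultimately obtain l where "?s \<longlonglongrightarrow> l"
    using incseq_convergent[of ?s 1] by blast
  then have "summable (\<lambda>n. ?s (Suc n) - ?s n)"
    by (rule telescope_summable)
  then have "summable (\<lambda>n. sqrt_iter T (Suc n) - sqrt_iter T n)"
    by (rule summable_comparison_test') (rule sqrt_iter_diff_le)
  then have "convergent (\<lambda>n. \<Sum>i<n. sqrt_iter T (Suc i) - sqrt_iter T i)"
    by (simp add: summable_iff_convergent)
  then have "convergent (sqrt_iter T)" by (simp add: sum_lessThan_telescope del: sqrt_iter.simps(2))
  then show ?thesis by (simp add: sqrt_fix_def convergent_LIMSEQ_iff)
qed

lemma sqrt_fix_eq:
  fixes T :: "'e::{banach,real_normed_algebra}"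
  assumes "norm T \<le> 1"
  shows "2 *\<^sub>R sqrt_fix T = T + sqrt_fix T * sqrt_fix T"
proof -
  have l: "sqrt_iter T \<longlonglongrightarrow> sqrt_fix T" by (rule sqrt_iter_tendsto[OF assms])
  have "(\<lambda>n. 2 *\<^sub>R sqrt_iter T (Suc n)) \<longlonglongrightarrow> 2 *\<^sub>R sqrt_fix T"
    by (intro tendsto_intros LIMSEQ_Suc l)
  moreover have "(\<lambda>n. 2 *\<^sub>R sqrt_iter T (Suc n)) \<longlonglongrightarrow> T + sqrt_fix T * sqrt_fix T"
    by simp (intro tendsto_intros l)
  ultimately show ?thesis by (rule LIMSEQ_unique)
qed

text \<open>The bound on the real iteration passes to the limit, which exists because
  \<open>2 * y - y\<^sup>2 = 1 - (1 - y)\<^sup>2\<close>. The freedom in \<open>y\<close> later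
  gives the sharp lower bound for the root of the frame operator.\<close>

lemma norm_sqrt_fix_le:
  fixes T :: "'e::{banach,real_normed_algebra}"
  assumes "0 \<le> y" "norm T + y\<^sup>2 \<le> 2 * y"
  shows "norm (sqrt_fix T) \<le> y"
proof -
  have "norm T \<le> 2 * y - y\<^sup>2" using assms by simp
  also have "\<dots> \<le> 1" using zero_le_power2[of "1 - y"] by (simp add: power2_eq_square algebra_simps)
  finally have "sqrt_iter T \<longlonglongrightarrow> sqrt_fix T" by (rule sqrt_iter_tendsto)
  moreover have "norm (sqrt_iter T n) \<le> y" for n
    using sqrt_iter_norm_le[of T n] sqrt_iter_real_bounds[of "norm T" y n] assms by simp
  ultimately show ?thesis
    by (intro LIMSEQ_le_const2[OF tendsto_norm]) auto
qed

lemma sqrt_fix_commute: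
  fixes T :: "'e::{banach,real_normed_algebra}"
  assumes "norm T \<le> 1" "z * T = T * z"
  shows "z * sqrt_fix T = sqrt_fix T * z"
proof -
  have *: "z * sqrt_iter T n = sqrt_iter T n * z" for n
  proof (induction n)
    case (Suc n)
    have "z * (sqrt_iter T n * sqrt_iter T n) = sqrt_iter T n * sqrt_iter T n * z"
      by (metis Suc mult.assoc)
    then show ?case by (simp add: distrib_left distrib_right assms(2))
  qed simp
  have l: "sqrt_iter T \<longlonglongrightarrow> sqrt_fix T" by (rule sqrt_iter_tendsto[OF assms(1)])
  have "(\<lambda>n. z * sqrt_iter T n) \<longlonglongrightarrow> z * sqrt_fix T" by (intro tendsto_intros l)
  moreover have "(\<lambda>n. z * sqrt_iter T n) \<longlonglongrightarrow> sqrt_fix T * z" unfolding * by (intro tendsto_intros l)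
  ultimately show ?thesis by (rule LIMSEQ_unique)
qed

section \<open>Adjoints in a Banach algebra\<close>

text \<open>\<open>adjt f g\<close> says that \<open>g\<close> is an adjoint of \<open>f\<close>; not every element needs to have one, so that
  the algebra can be that of all bounded real-linear operators. The element \<open>J\<close> plays the role
  of the scalar \<open>\<i>\<close>.\<close>

locale adjoint_relation =
  fixes adjt :: "'e::{banach,real_normed_algebra,monoid_mult} \<Rightarrow> 'e \<Rightarrow> bool" and J :: 'e
  assumes adjt_commute: "adjt f g \<Longrightarrow> adjt g f"
    and adjt_add: "adjt f f' \<Longrightarrow> adjt g g' \<Longrightarrow> adjt (f + g) (f' + g')"
    and adjt_scaleR: "adjt f f' \<Longrightarrow> adjt (r *\<^sub>R f) (r *\<^sub>R f')"
    and adjt_mult: "adjt f f' \<Longrightarrow> adjt g g' \<Longrightarrow> adjt (f * g) (g' * f')"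
    and adjt_one: "adjt 1 1"
    and adjt_tendsto: "F \<longlonglongrightarrow> f \<Longrightarrow> (\<And>n. adjt (F n) (F n)) \<Longrightarrow> adjt f f"
    and norm_adjt_square: "adjt f g \<Longrightarrow> (norm f)\<^sup>2 \<le> norm (g * f)"
    and norm_one_le: "norm (1::'e) \<le> 1"
    and adjt_J: "adjt J (- J)"
    and J_J: "J * J = - 1"
    and adjt_J_commute: "adjt f g \<Longrightarrow> J * f = f * J"
begin

abbreviation selfadj :: "'e \<Rightarrow> bool" where
  "selfadj h \<equiv> adjt h h"

definition pos :: "'e \<Rightarrow> bool" where
  "pos h \<longleftrightarrow> selfadj h \<and> (\<exists>t\<ge>0. norm (t *\<^sub>R 1 - h) \<le> t)"

lemma adjt_uminus: "adjt f g \<Longrightarrow> adjt (- f) (- g)"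
  using adjt_scaleR[of f g "-1"] by simp

lemma adjt_diff: "adjt f f' \<Longrightarrow> adjt g g' \<Longrightarrow> adjt (f - g) (f' - g')"
  using adjt_add[of f f' "- g" "- g'"] adjt_uminus[of g g'] by simp

lemma selfadj_zero: "selfadj 0"
  using adjt_scaleR[OF adjt_one, of 0] by simp

lemma norm_adjt_le: "adjt f g \<Longrightarrow> norm f \<le> norm g"
proof -
  assume fg: "adjt f g"
  have "norm f * norm f \<le> norm g * norm f"
    using norm_adjt_square[OF fg] norm_mult_ineq[of g f] by (simp add: power2_eq_square)
  then show ?thesis by (cases "norm f = 0") auto
qed

lemma norm_adjt_eq: "adjt f g \<Longrightarrow> norm f = norm g"
  by (meson adjt_commute norm_adjt_le order_antisym)

lemma norm_adjt_mult: "adjt f g \<Longrightarrow> norm (g * f) = (norm f)\<^sup>2"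
  using norm_adjt_square[of f g] norm_mult_ineq[of g f] norm_adjt_eq[of f g]
  by (simp add: power2_eq_square)

lemma selfadj_square_eq_0: "selfadj h \<Longrightarrow> h * h = 0 \<Longrightarrow> h = 0"
  using norm_adjt_mult[of h h] by simp

lemma selfadj_sqrt_fix:
  assumes "norm T \<le> 1" "selfadj T"
  shows "selfadj (sqrt_fix T)"
proof (rule adjt_tendsto[OF sqrt_iter_tendsto[OF assms(1)]])
  show "selfadj (sqrt_iter T n)" for n
    by (induction n) (auto intro!: adjt_scaleR adjt_add adjt_mult assms selfadj_zero)
qed

lemma pos_selfadj: "pos h \<Longrightarrow> selfadj h"
  by (simp add: pos_def)

text \<open>With \<open>T = 1 - h / t\<close> the element \<open>Y = sqrt_fix T\<close> stands for
  one minus the root of \<open>h / t\<close>. The commutation clause replaces functional calculus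
  below: it makes roots of commuting elements commute.\<close>

lemma pos_sqrt:
  assumes "pos h"
  obtains r where "pos r" "r * r = h" "\<And>z. z * h = h * z \<Longrightarrow> z * r = r * z"
proof -
  from assms obtain t where t: "t \<ge> 0" "norm (t *\<^sub>R 1 - h) \<le> t" and h: "selfadj h"
    by (auto simp: pos_def)
  show ?thesis
  proof (cases "t = 0")
    case True
    with t have "h = 0" by simp
    with True h show ?thesis by (intro that[of 0]) (auto simp: pos_def intro!: exI[of _ 0])
  next
    case False
    with t have "t > 0" by simp
    define T where "T = 1 - (1/t) *\<^sub>R h"
    have hT: "h = t *\<^sub>R 1 - t *\<^sub>R T" using \<open>t > 0\<close> by (simp add: T_def algebra_simps)
    have "t * norm T = norm (t *\<^sub>R 1 - h)" using \<open>t > 0\<close> by (simp add: hT)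
    then have "t * norm T \<le> t * 1" using t(2) by linarith
    then have nT: "norm T \<le> 1" using \<open>t > 0\<close> by (simp only: mult_le_cancel_left_pos)
    have sT: "selfadj T" unfolding T_def by (intro adjt_diff adjt_one adjt_scaleR h)
    define Y where "Y = sqrt_fix T"
    have nY: "norm Y \<le> 1" unfolding Y_def using nT by (intro norm_sqrt_fix_le) auto
    have Y2: "Y * Y = Y + Y - T" using sqrt_fix_eq[OF nT] unfolding Y_def
      by (simp add: scaleR_2 algebra_simps)
    define r where "r = sqrt t *\<^sub>R (1 - Y)"
    have "r * r = (sqrt t * sqrt t) *\<^sub>R (1 - Y - Y + Y * Y)"
      by (simp add: r_def algebra_simps)
    then have "r * r = h" using \<open>t > 0\<close> by (simp add: Y2 hT algebra_simps)
    moreover have "pos r"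
      unfolding pos_def
    proof (intro conjI exI[of _ "sqrt t"])
      show "selfadj r" unfolding r_def Y_def
        by (intro adjt_diff adjt_one adjt_scaleR selfadj_sqrt_fix nT sT)
      show "norm (sqrt t *\<^sub>R 1 - r) \<le> sqrt t"
        using nY \<open>t > 0\<close> by (simp add: r_def algebra_simps mult_left_le)
    qed (use t in simp)
    moreover have "z * r = r * z" if "z * h = h * z" for z
    proof -
      have "z * T = T * z" using that by (simp add: T_def algebra_simps)
      then have "z * Y = Y * z" unfolding Y_def by (rule sqrt_fix_commute[OF nT])
      then show ?thesis by (simp add: r_def algebra_simps)
    qed
    ultimately show ?thesis by (intro that)
  qed
qed

text \<open>The element \<open>u = r + J m\<close> satisfies \<open>u\<^sup>* u = t\<close>, and \<open>r\<close> is the mean of \<open>u\<close> and \<open>u\<^sup>*\<close>.\<close>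

lemma norm_le_of_square_sum:
  assumes r: "selfadj r" and m: "selfadj m" and rm: "r * m = m * r"
    and sum: "r * r + m * m = t *\<^sub>R 1" and t: "0 \<le> t"
  shows "(norm r)\<^sup>2 \<le> t"
proof -
  define u u' where "u = r + J * m" and "u' = r - J * m"
  have Jr: "J * r = r * J" and Jm: "J * m = m * J" using r m adjt_J_commute by blast+
  have "adjt (J * m) (m * - J)" by (intro adjt_mult adjt_J m)
  then have "adjt u u'" unfolding u_def u'_def using adjt_add[OF r] Jm by fastforce
  have "J * m * (J * m) = J * (m * J) * m" by (simp add: mult.assoc)
  also have "\<dots> = (J * J) * (m * m)" by (simp add: Jm[symmetric] mult.assoc)
  finally have JJ: "J * m * (J * m) = - (m * m)" by (simp add: J_J)
  have Jrm: "J * m * r = r * (J * m)"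
    by (metis Jr mult.assoc rm)
  have "u' * u = r * r + m * m" unfolding u_def u'_def by (simp add: algebra_simps JJ[unfolded mult.assoc] Jrm[unfolded mult.assoc])
  then have "norm (u' * u) \<le> t" using sum norm_one_le t by (simp add: mult_left_le)
  then have "(norm u)\<^sup>2 \<le> t" using norm_adjt_mult[OF \<open>adjt u u'\<close>] by simp
  moreover have "norm r \<le> norm u"
  proof -
    have "2 *\<^sub>R r = u + u'" by (simp add: u_def u'_def scaleR_2)
    then have "2 * norm r \<le> norm u + norm u'" by (metis norm_scaleR norm_triangle_ineq abs_numeral)
    then show ?thesis using norm_adjt_eq[OF \<open>adjt u u'\<close>] by simp
  qed
  ultimately show ?thesis by (meson norm_ge_zero order_trans power_mono)
qed

text \<open>The element \<open>t *\<^sub>R 1 - h * h\<close> is positive straight from the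
  definition, with \<open>t\<close> as the constant. Its root \<open>k\<close> commutes with
  \<open>h\<close>, and \<open>k * k + h * h = t *\<^sub>R 1\<close> bounds
  \<open>norm k\<close>.\<close>

lemma norm_diff_square_le:
  assumes h: "selfadj h" and t: "(norm h)\<^sup>2 \<le> t"
  shows "norm (t *\<^sub>R 1 - h * h) \<le> t"
proof -
  have t0: "0 \<le> t" using t zero_le_power2 order_trans by blast
  have "norm (t *\<^sub>R 1 - (t *\<^sub>R 1 - h * h)) \<le> t" using t norm_adjt_mult[OF h] by simp
  moreover have "selfadj (t *\<^sub>R 1 - h * h)"
    by (intro adjt_diff adjt_scaleR adjt_one adjt_mult h)
  ultimately have "pos (t *\<^sub>R 1 - h * h)" using t0 by (auto simp: pos_def)
  then obtain k where k: "pos k" "k * k = t *\<^sub>R 1 - h * h"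
    "\<And>z. z * (t *\<^sub>R 1 - h * h) = (t *\<^sub>R 1 - h * h) * z \<Longrightarrow> z * k = k * z"
    by (rule pos_sqrt) blast
  have "h * k = k * h" by (rule k(3)) (simp add: algebra_simps)
  then have "(norm k)\<^sup>2 \<le> t"
    by (intro norm_le_of_square_sum[OF pos_selfadj[OF k(1)] h]) (auto simp: k t0)
  then show ?thesis using norm_adjt_mult[OF pos_selfadj[OF k(1)]] by (simp add: k)
qed

lemma pos_square: "selfadj h \<Longrightarrow> pos (h * h)"
  unfolding pos_def using norm_diff_square_le[of h "(norm h)\<^sup>2"]
  by (auto intro: adjt_mult intro!: exI[of _ "(norm h)\<^sup>2"])

text \<open>The definition of \<open>pos\<close> provides a single constant \<open>t\<close>;
  writing \<open>h\<close> as the square of its root extends the estimate to every \<open>t\<close>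
  from \<open>norm h\<close> on.\<close>

lemma pos_norm_diff_le:
  assumes "pos h" "norm h \<le> t"
  shows "norm (t *\<^sub>R 1 - h) \<le> t"
proof -
  obtain r where r: "pos r" "r * r = h" using pos_sqrt[OF assms(1)] by blast
  show ?thesis
    using norm_diff_square_le[OF pos_selfadj[OF r(1)], of t]
      norm_adjt_mult[OF pos_selfadj[OF r(1)]] r(2) assms(2) by simp
qed

lemma pos_diff_of_norm_le:
  assumes "selfadj h" "norm h \<le> t"
  shows "pos (t *\<^sub>R 1 - h)"
  unfolding pos_def using assms order_trans[OF norm_ge_zero assms(2)]
  by (auto intro!: adjt_diff adjt_scaleR adjt_one)

lemma pos_add: "pos a \<Longrightarrow> pos b \<Longrightarrow> pos (a + b)"
proof -
  assume "pos a" "pos b"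
  then obtain s t where st: "s \<ge> 0" "t \<ge> 0" "norm (s *\<^sub>R 1 - a) \<le> s" "norm (t *\<^sub>R 1 - b) \<le> t"
    by (auto simp: pos_def)
  have "(s + t) *\<^sub>R 1 - (a + b) = (s *\<^sub>R 1 - a) + (t *\<^sub>R 1 - b)" by (simp add: algebra_simps)
  then have "norm ((s + t) *\<^sub>R 1 - (a + b)) \<le> norm (s *\<^sub>R 1 - a) + norm (t *\<^sub>R 1 - b)"
    by (simp only: norm_triangle_ineq)
  also have "\<dots> \<le> s + t" by (rule add_mono[OF st(3,4)])
  finally have "norm ((s + t) *\<^sub>R 1 - (a + b)) \<le> s + t" .
  with st \<open>pos a\<close> \<open>pos b\<close> show ?thesis
    unfolding pos_def by (metis adjt_add add_nonneg_nonneg)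
qed

lemma pos_scaleR: "pos a \<Longrightarrow> 0 \<le> s \<Longrightarrow> pos (s *\<^sub>R a)"
proof -
  assume a: "pos a" and s: "0 \<le> s"
  then obtain t where t: "t \<ge> 0" "norm (t *\<^sub>R 1 - a) \<le> t" by (auto simp: pos_def)
  have "(s * t) *\<^sub>R 1 - s *\<^sub>R a = s *\<^sub>R (t *\<^sub>R 1 - a)" by (simp add: algebra_simps)
  then have "norm ((s * t) *\<^sub>R 1 - s *\<^sub>R a) \<le> s * t" using s t by (simp add: mult_left_mono)
  with s t pos_selfadj[OF a] show ?thesis unfolding pos_def by (auto intro!: adjt_scaleR exI[of _ "s * t"])
qed

text \<open>The commutation clause of \<open>pos_sqrt\<close>, applied twice, makes the roots
  \<open>r\<close> and \<open>s\<close> commute, so \<open>a * b\<close> is the square of the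
  self-adjoint \<open>r * s\<close>.\<close>

lemma pos_mult:
  assumes "pos a" "pos b" "a * b = b * a"
  shows "pos (a * b)"
proof -
  obtain r where r: "pos r" "r * r = a" "\<And>z. z * a = a * z \<Longrightarrow> z * r = r * z"
    using pos_sqrt[OF assms(1)] by blast
  obtain s where s: "pos s" "s * s = b" "\<And>z. z * b = b * z \<Longrightarrow> z * s = s * z"
    using pos_sqrt[OF assms(2)] by blast
  have "b * r = r * b" using assms(3) by (intro r(3)) simp
  then have rs: "r * s = s * r" by (intro s(3)) simp
  have "selfadj (r * s)" using adjt_mult[OF pos_selfadj[OF r(1)] pos_selfadj[OF s(1)]] rs by simp
  moreover have "(r * s) * (r * s) = a * b" by (metis r(2) s(2) rs mult.assoc)
  ultimately show ?thesis using pos_square[of "r * s"] by simp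
qed

text \<open>The roots of \<open>a\<close> and of \<open>t *\<^sub>R 1 - a\<close> commute and their
  squares add up to \<open>t *\<^sub>R 1\<close>.\<close>

lemma norm_le_of_pos_diff:
  assumes a: "pos a" and b: "pos (t *\<^sub>R 1 - a)" and t: "0 \<le> t"
  shows "norm a \<le> t"
proof -
  obtain r where r: "pos r" "r * r = a" "\<And>z. z * a = a * z \<Longrightarrow> z * r = r * z"
    using pos_sqrt[OF a] by blast
  obtain m where m: "pos m" "m * m = t *\<^sub>R 1 - a"
    "\<And>z. z * (t *\<^sub>R 1 - a) = (t *\<^sub>R 1 - a) * z \<Longrightarrow> z * m = m * z"
    using pos_sqrt[OF b] by blast
  have "a * r = r * a" by (intro r(3)) simp
  then have "r * m = m * r" by (intro m(3)) (simp add: algebra_simps)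
  then have "(norm r)\<^sup>2 \<le> t"
    by (intro norm_le_of_square_sum[OF pos_selfadj[OF r(1)] pos_selfadj[OF m(1)]])
      (auto simp: r(2) m(2) t)
  then show ?thesis using norm_adjt_mult[OF pos_selfadj[OF r(1)]] by (simp add: r(2))
qed

lemma norm_mono:
  assumes "pos a" "pos b"
  shows "norm a \<le> norm (a + b)"
proof -
  let ?t = "norm (a + b)"
  have "pos (?t *\<^sub>R 1 - (a + b))"
    by (rule pos_diff_of_norm_le) (use pos_add[OF assms] pos_selfadj in auto)
  from pos_add[OF this assms(2)] have "pos (?t *\<^sub>R 1 - a)" by (simp add: algebra_simps)
  with assms(1) show ?thesis by (rule norm_le_of_pos_diff) simp
qed

text \<open>The product \<open>a (2 d - a) = d\<^sup>2 - (d - a)\<^sup>2\<close> of commuting positive elements has a square root \<open>m\<close>,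
  so that \<open>(d - a)\<^sup>2 + m\<^sup>2 = d\<^sup>2\<close>.\<close>

lemma norm_centre_diff_le:
  assumes a: "pos a" and "norm a \<le> 2 * d"
  shows "norm (d *\<^sub>R 1 - a) \<le> d"
proof -
  have d: "0 \<le> d" using norm_ge_zero[of a] assms(2) by linarith
  have b: "pos ((2 * d) *\<^sub>R 1 - a)" by (intro pos_diff_of_norm_le pos_selfadj assms)
  have "pos (a * ((2 * d) *\<^sub>R 1 - a))" by (intro pos_mult a b) (simp add: algebra_simps)
  then obtain m where m: "pos m" "m * m = a * ((2 * d) *\<^sub>R 1 - a)"
    "\<And>z. z * (a * ((2 * d) *\<^sub>R 1 - a)) = (a * ((2 * d) *\<^sub>R 1 - a)) * z \<Longrightarrow> z * m = m * z"
    by (rule pos_sqrt) blast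
  have am: "a * m = m * a" by (intro m(3)) (simp add: algebra_simps)
  have "(norm (d *\<^sub>R 1 - a))\<^sup>2 \<le> d\<^sup>2"
  proof (rule norm_le_of_square_sum[OF _ pos_selfadj[OF m(1)]])
    show "selfadj (d *\<^sub>R 1 - a)" by (intro adjt_diff adjt_scaleR adjt_one pos_selfadj a)
    show "(d *\<^sub>R 1 - a) * m = m * (d *\<^sub>R 1 - a)" using am by (simp add: algebra_simps)
    have "a * ((2 * d) *\<^sub>R 1) = d *\<^sub>R a + d *\<^sub>R a"
      by (simp flip: scaleR_add_left)
    then show "(d *\<^sub>R 1 - a) * (d *\<^sub>R 1 - a) + m * m = d\<^sup>2 *\<^sub>R 1"
      unfolding m(2) right_diff_distrib by (simp add: algebra_simps power2_eq_square)
  qed simp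
  then show ?thesis using d by (simp add: abs_le_square_iff)
qed

text \<open>An element \<open>c\<^sup>* c\<close> cannot be negative: writing \<open>e = c c\<^sup>*\<close>, which is
  positive because \<open>c\<^sup>* c + c c\<^sup>*\<close> is a sum of squares, the powers of \<open>1 - e/t\<close> are bounded, but
  \<open>c\<^sup>* (1 - e/t)\<^sup>n c = - (1 + p\<^sup>2/t)\<^sup>n p\<^sup>2\<close> grows linearly in \<open>n\<close> unless \<open>p = 0\<close>.\<close>

lemma adjt_mult_negative:
  assumes c: "adjt c c'" and p: "selfadj p" and cp: "c' * c = - (p * p)"
  shows "p = 0"
proof -
  have c': "adjt c' c" by (rule adjt_commute[OF c])
  define e where "e = c * c'"
  define h where "h = c + c'"
  define k where "k = J * (c - c')"
  have Jc: "J * c = c * J" and Jc': "J * c' = c' * J"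
    using c c' adjt_J_commute by blast+
  have sh: "selfadj h" unfolding h_def using adjt_add[OF c c'] by (simp add: add.commute)
  have sk: "selfadj k"
  proof -
    have "adjt k ((c' - c) * (- J))" unfolding k_def by (intro adjt_mult adjt_J adjt_diff c c')
    moreover have "(c' - c) * (- J) = k" unfolding k_def by (simp add: algebra_simps Jc Jc')
    ultimately show ?thesis by simp
  qed
  have "k * k = J * ((c - c') * J) * (c - c')" unfolding k_def by (simp add: mult.assoc)
  also have "(c - c') * J = J * (c - c')" by (simp add: algebra_simps Jc Jc')
  also have "J * (J * (c - c')) * (c - c') = (J * J) * ((c - c') * (c - c'))"
    by (simp only: mult.assoc)
  finally have kk: "k * k = - ((c - c') * (c - c'))" by (simp add: J_J)
  have "h * h + k * k = (c' * c + e) + (c' * c + e)"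
    unfolding kk h_def e_def by (simp add: algebra_simps)
  then have "h * h + k * k = 2 *\<^sub>R (e - p * p)" by (simp add: cp scaleR_2)
  then have "e = (1/2) *\<^sub>R (h * h + k * k) + p * p" by simp
  then have pe: "pos e"
    using sh sk p by (auto intro!: pos_add pos_scaleR pos_square)
  \<comment> \<open>Any \<open>t\<close> from \<open>norm e\<close> on makes \<open>f\<close> a
    contraction; the added \<open>1\<close> keeps \<open>t\<close> nonzero when
    \<open>e = 0\<close>.\<close>
  define t where "t = norm e + 1"
  have t: "t > 0" unfolding t_def by (simp add: add_nonneg_pos)
  define q where "q = (1/t) *\<^sub>R (p * p)"
  define f where "f = 1 - (1/t) *\<^sub>R e"
  have "t *\<^sub>R f = t *\<^sub>R 1 - e" using t by (simp add: f_def algebra_simps)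
  then have "norm (t *\<^sub>R f) \<le> t" using pos_norm_diff_le[OF pe, of t] by (simp add: t_def)
  then have "t * norm f \<le> t * 1" using t by (simp only: norm_scaleR abs_of_pos mult_1_right)
  then have nf: "norm f \<le> 1" using t by (simp only: mult_le_cancel_left_pos)
  \<comment> \<open>Here \<open>e * c = c * (c' * c) = - (c * (p * p))\<close>, so moving
    \<open>f\<close> across \<open>c\<close> flips the sign and turns the contraction into
    \<open>1 + q\<close>.\<close>
  have fc: "f * c = c * (1 + q)"
    unfolding f_def q_def e_def using arg_cong[OF cp, of "\<lambda>z. c * z"] by (simp add: algebra_simps)
  have fnc: "f ^ n * c = c * (1 + q) ^ n" for n
  proof (induction n)
    case (Suc n)
    have "f ^ Suc n * c = f ^ n * (f * c)" by (simp add: power_Suc2 mult.assoc del: power_Suc)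
    also have "\<dots> = c * ((1 + q) ^ n * (1 + q))" by (simp add: fc flip: mult.assoc) (simp add: Suc mult.assoc)
    finally show ?case by (simp add: power_Suc2 del: power_Suc)
  qed simp
  define w where "w n = (p * p) * (1 + q) ^ n" for n
  have nfn: "norm (f ^ n) \<le> 1" for n
  proof (induction n)
    case (Suc n)
    then show ?case using nf norm_mult_ineq[of f "f ^ n"] mult_le_one[of "norm f" "norm (f ^ n)"] by simp
  qed (simp add: norm_one_le)
  have nw: "norm (w n) \<le> norm c' * norm c" for n
  proof -
    have "w n = - (c' * (f ^ n * c))" unfolding w_def fnc by (simp add: cp flip: mult.assoc)
    then have "norm (w n) \<le> norm c' * norm (f ^ n * c)" by (simp add: norm_mult_ineq)
    also have "\<dots> \<le> norm c' * (1 * norm c)"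
      by (intro mult_left_mono order_trans[OF norm_mult_ineq] mult_right_mono nfn) auto
    finally show ?thesis by simp
  qed
  have pq: "pos q" and pp: "pos (p * p)" unfolding q_def using t p by (auto intro!: pos_scaleR pos_square)
  have wS: "w (Suc n) = w n + w n * q" for n
    unfolding w_def by (simp add: power_Suc2 algebra_simps del: power_Suc)
  have pq_comm: "p * p * q = q * (p * p)" unfolding q_def by (simp add: mult.assoc)
  have wq: "w n * q = q * w n" for n
  proof (induction n)
    case 0
    show ?case by (simp add: w_def pq_comm)
  next
    case (Suc n)
    have "w (Suc n) * q = w n * q + (w n * q) * q" by (simp add: wS distrib_right)
    also have "\<dots> = q * w n + q * (w n * q)" unfolding Suc by (simp only: mult.assoc Suc)
    finally show ?case by (simp add: wS distrib_left)
  qed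
  \<comment> \<open>An operator form of Bernoulli's inequality. The second conjunct is carried along
    because its product with \<open>q\<close> is exactly what the first gains in each step.\<close>
  have *: "pos (w n - p * p - real n *\<^sub>R (p * p * q)) \<and> pos (w n - p * p)" for n
  proof (induction n)
    case 0
    show ?case using pos_scaleR[OF pp, of 0] by (simp add: w_def)
  next
    case (Suc n)
    have "pos ((w n - p * p) * q)"
      by (rule pos_mult[OF conjunct2[OF Suc] pq])
        (simp only: left_diff_distrib right_diff_distrib wq pq_comm)
    then have "pos ((w n - p * p - real n *\<^sub>R (p * p * q)) + (w n - p * p) * q)"
      using Suc by (intro pos_add) auto
    moreover have "(w n - p * p - real n *\<^sub>R (p * p * q)) + (w n - p * p) * q =
       w (Suc n) - p * p - real (Suc n) *\<^sub>R (p * p * q)"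
      by (simp add: wS algebra_simps)
    moreover have "pos ((p * p) * q)" by (rule pos_mult[OF pp pq pq_comm])
    then have "pos ((w n - p * p) + ((w n - p * p) * q + (p * p) * q))"
      using Suc \<open>pos ((w n - p * p) * q)\<close> by (intro pos_add) auto
    moreover have "(w n - p * p) + ((w n - p * p) * q + (p * p) * q) = w (Suc n) - p * p"
      by (simp add: wS algebra_simps)
    ultimately show ?case by simp
  qed
  have "real n * norm (p * p * q) \<le> norm c' * norm c" for n
  proof -
    have a: "pos (real n *\<^sub>R (p * p * q))" by (rule pos_scaleR[OF pos_mult[OF pp pq pq_comm]]) simp
    have "pos ((w n - p * p - real n *\<^sub>R (p * p * q)) + p * p)"
      by (rule pos_add[OF conjunct1[OF *] pp])
    then have b: "pos (w n - real n *\<^sub>R (p * p * q))" by simp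
    show ?thesis using norm_mono[OF a b] nw[of n] by simp
  qed
  then have bound: "\<not> norm c' * norm c < real n * norm (p * p * q)" for n by (simp only: not_less)
  have "\<not> 0 < norm (p * p * q)"
  proof
    assume "0 < norm (p * p * q)"
    then obtain n where "norm c' * norm c < real n * norm (p * p * q)"
      by (rule ex_less_of_nat_mult[THEN exE])
    with bound show False by blast
  qed
  then have "p * p * q = 0" by simp
  then have "(p * p) * (p * p) = 0" using t by (simp add: q_def)
  then have "p * p = 0" by (rule selfadj_square_eq_0[OF adjt_mult[OF p p]])
  then show ?thesis by (rule selfadj_square_eq_0[OF p])
qed

text \<open>For \<open>a = b\<^sup>* b\<close> and \<open>g = \<bar>a\<bar> - a\<close> one has \<open>g a g = - \<bar>a\<bar> g\<^sup>2\<close>, so \<open>c = b g\<close> falls under the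
  preceding lemma and \<open>a = \<bar>a\<bar>\<close>.\<close>

lemma pos_adjt_mult:
  assumes b: "adjt b b'"
  shows "pos (b' * b)"
proof -
  define a where "a = b' * b"
  have sa: "selfadj a" unfolding a_def by (intro adjt_mult b adjt_commute[OF b])
  obtain m where m: "pos m" "m * m = a * a" "\<And>z. z * (a * a) = (a * a) * z \<Longrightarrow> z * m = m * z"
    using pos_sqrt[OF pos_square[OF sa]] by blast
  have am: "a * m = m * a" by (intro m(3)) (simp add: mult.assoc)
  \<comment> \<open>A second root is taken so that \<open>g * m * g\<close> becomes the square of
    \<open>r * g\<close>, the shape that \<open>adjt_mult_negative\<close> requires.\<close>
  obtain r where r: "pos r" "r * r = m" "\<And>z. z * m = m * z \<Longrightarrow> z * r = r * z"
    using pos_sqrt[OF m(1)] by blast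
  have ar: "a * r = r * a" by (intro r(3) am)
  have mr: "m * r = r * m" by (intro r(3)) simp
  define g where "g = m - a"
  have sg: "selfadj g" unfolding g_def by (intro adjt_diff sa pos_selfadj m)
  have rg: "r * g = g * r" unfolding g_def by (simp add: algebra_simps ar mr)
  have ag: "a * g = - (m * g)" unfolding g_def by (simp add: algebra_simps m(2) am)
  have mg: "m * g = g * m" unfolding g_def by (simp add: algebra_simps am)
  have "adjt (b * g) (g * b')" by (intro adjt_mult b sg)
  moreover have srg: "selfadj (r * g)" using adjt_mult[OF pos_selfadj[OF r(1)] sg] rg by simp
  moreover have "(g * b') * (b * g) = - (r * g * (r * g))"
  proof -
    have "(g * b') * (b * g) = g * (a * g)" by (simp add: a_def mult.assoc)
    also have "\<dots> = - (g * (r * r) * g)" by (simp add: ag r(2) mult.assoc)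
    also have "g * (r * r) * g = (g * r) * (r * g)" by (simp only: mult.assoc)
    also have "\<dots> = r * g * (r * g)" by (simp only: rg)
    finally show ?thesis .
  qed
  ultimately have "r * g = 0" by (rule adjt_mult_negative)
  then have "m * g = 0" by (simp add: r(2)[symmetric] mult.assoc)
  \<comment> \<open>Since \<open>a * g = - (m * g)\<close>, this makes \<open>g * g\<close> twice
    \<open>m * g\<close>, which has just been shown to vanish.\<close>
  moreover have "g * g = m * g - a * g" unfolding left_diff_distrib[symmetric] by (simp add: g_def)
  ultimately have "g * g = 0" by (simp add: ag)
  then have "g = 0" by (rule selfadj_square_eq_0[OF sg])
  then show ?thesis using m(1) by (simp add: g_def a_def)
qed

end

section \<open>Bounded operators as a ring\<close>

text \<open>A copy of the bounded operators whose ring product is composition, so that the results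
  on algebras with an adjoint relation apply to operators.\<close>

typedef (overloaded) ('x::real_normed_vector) endo = "UNIV :: ('x \<Rightarrow>\<^sub>L 'x) set"
  morphisms blinfun_of Endo ..

setup_lifting type_definition_endo

definition app :: "'x::real_normed_vector endo \<Rightarrow> 'x \<Rightarrow> 'x" where
  "app f x = blinfun_apply (blinfun_of f) x"

lemma endo_eqI: "(\<And>x. app f x = app g x) \<Longrightarrow> f = g"
  unfolding app_def by (metis blinfun_eqI blinfun_of_inject)

instantiation endo :: (real_normed_vector) "{real_normed_vector, ring, monoid_mult}"
begin

lift_definition zero_endo :: "'a endo" is 0 .
lift_definition one_endo :: "'a endo" is id_blinfun .
lift_definition plus_endo :: "'a endo \<Rightarrow> 'a endo \<Rightarrow> 'a endo" is "(+)" .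
lift_definition minus_endo :: "'a endo \<Rightarrow> 'a endo \<Rightarrow> 'a endo" is "(-)" .
lift_definition uminus_endo :: "'a endo \<Rightarrow> 'a endo" is uminus .
lift_definition times_endo :: "'a endo \<Rightarrow> 'a endo \<Rightarrow> 'a endo" is "(o\<^sub>L)" .
lift_definition scaleR_endo :: "real \<Rightarrow> 'a endo \<Rightarrow> 'a endo" is scaleR .
lift_definition norm_endo :: "'a endo \<Rightarrow> real" is norm .
lift_definition dist_endo :: "'a endo \<Rightarrow> 'a endo \<Rightarrow> real" is dist .
lift_definition sgn_endo :: "'a endo \<Rightarrow> 'a endo" is sgn .

definition uniformity_endo :: "('a endo \<times> 'a endo) filter" where
  "uniformity_endo = (INF e\<in>{0<..}. principal {(x, y). dist x y < e})"

definition open_endo :: "'a endo set \<Rightarrow> bool" where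
  "open_endo S = (\<forall>x\<in>S. \<forall>\<^sub>F (x', y) in uniformity. x' = x \<longrightarrow> y \<in> S)"

instance
proof
  fix a b c :: "'a endo" and r s :: real and S :: "'a endo set"
  show "dist a b = norm (a - b)" by transfer (rule dist_norm)
  show "(uniformity :: ('a endo \<times> 'a endo) filter) = (INF e\<in>{0<..}. principal {(x, y). dist x y < e})"
    by (rule uniformity_endo_def)
  show "open S = (\<forall>x\<in>S. \<forall>\<^sub>F (x', y) in uniformity. x' = x \<longrightarrow> y \<in> S)" by (rule open_endo_def)
  show "sgn a = inverse (norm a) *\<^sub>R a" by transfer (rule sgn_div_norm)
  show "norm a = 0 \<longleftrightarrow> a = 0" by transfer simp
  show "norm (a + b) \<le> norm a + norm b" by transfer (rule norm_triangle_ineq)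
  show "norm (r *\<^sub>R a) = \<bar>r\<bar> * norm a" by transfer simp
  show "a + b + c = a + (b + c)" "a + b = b + a" "0 + a = a" "- a + a = 0" "a - b = a + - b"
    by (transfer; simp)+
  show "r *\<^sub>R (a + b) = r *\<^sub>R a + r *\<^sub>R b" "(r + s) *\<^sub>R a = r *\<^sub>R a + s *\<^sub>R a"
    "r *\<^sub>R s *\<^sub>R a = (r * s) *\<^sub>R a" "1 *\<^sub>R a = a"
    by (transfer; simp add: algebra_simps)+
  show "a * b * c = a * (b * c)" "1 * a = a" "a * 1 = a"
    by (transfer; auto intro!: blinfun_eqI)+
  show "(a + b) * c = a * c + b * c" "a * (b + c) = a * b + a * c"
    by (transfer; simp add: bounded_bilinear.add_left[OF bounded_bilinear_blinfun_compose]
        bounded_bilinear.add_right[OF bounded_bilinear_blinfun_compose])+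
qed

end

instance endo :: (real_normed_vector) real_normed_algebra
proof
  fix a b :: "'a endo" and r :: real
  show "r *\<^sub>R a * b = r *\<^sub>R (a * b)" "a * r *\<^sub>R b = r *\<^sub>R (a * b)"
    by (transfer; simp add: bounded_bilinear.scaleR_left[OF bounded_bilinear_blinfun_compose]
        bounded_bilinear.scaleR_right[OF bounded_bilinear_blinfun_compose])+
  show "norm (a * b) \<le> norm a * norm b" by transfer (rule norm_blinfun_compose)
qed

instance endo :: (banach) banach
proof
  fix X :: "nat \<Rightarrow> 'a endo"
  assume "Cauchy X"
  then have "Cauchy (\<lambda>n. blinfun_of (X n))"
    by (simp add: Cauchy_def dist_endo.rep_eq)
  then obtain L where "(\<lambda>n. blinfun_of (X n)) \<longlonglongrightarrow> L"
    using Cauchy_convergent convergent_def by blast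
  then have "X \<longlonglongrightarrow> Endo L"
    by (simp add: tendsto_iff dist_endo.rep_eq Endo_inverse)
  then show "convergent X" by (auto simp: convergent_def)
qed

lemma bounded_linear_app: "bounded_linear (app f)"
  unfolding app_def[abs_def] by (rule blinfun.bounded_linear_right)

lemma app_simps [simp]:
  "app (f + g) x = app f x + app g x" "app (f - g) x = app f x - app g x"
  "app (- f) x = - app f x" "app (f * g) x = app f (app g x)" "app (r *\<^sub>R f) x = r *\<^sub>R app f x"
  "app 0 x = 0" "app 1 x = x"
  by (simp_all add: app_def plus_endo.rep_eq minus_endo.rep_eq uminus_endo.rep_eq times_endo.rep_eq
      scaleR_endo.rep_eq zero_endo.rep_eq one_endo.rep_eq blinfun.bilinear_simps)

lemma app_linear [simp]:
  "app f (x + y) = app f x + app f y" "app f (x - y) = app f x - app f y"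
  "app f (- x) = - app f x" "app f (r *\<^sub>R x) = r *\<^sub>R app f x" "app f 0 = 0"
  by (simp_all add: app_def blinfun.bilinear_simps)

lemma norm_app_le: "norm (app f x) \<le> norm f * norm x"
  by (simp add: app_def norm_endo.rep_eq norm_blinfun)

lemma norm_endo_le: "0 \<le> b \<Longrightarrow> (\<And>x. norm (app f x) \<le> b * norm x) \<Longrightarrow> norm f \<le> b"
  by (simp add: app_def norm_endo.rep_eq norm_blinfun_bound)

lemma tendsto_app:
  assumes "F \<longlonglongrightarrow> f"
  shows "(\<lambda>n. app (F n) x) \<longlonglongrightarrow> app f x"
proof -
  have "(\<lambda>n. blinfun_of (F n)) \<longlonglongrightarrow> blinfun_of f"
    using assms by (simp add: tendsto_iff dist_endo.rep_eq)
  then show ?thesis unfolding app_def by (intro tendsto_intros)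
qed

lemma ex_endo:
  assumes "bounded_linear f"
  obtains g where "\<And>x. app g x = f x"
  by (metis app_def Endo_inverse UNIV_I bounded_linear_Blinfun_apply assms)

section \<open>Elementary facts on C*-algebras and Hilbert modules\<close>

lemma scaleC_minus_one: "(- 1) *\<^sub>C x = - (x::'x::complex_banach)"
  using scaleR_scaleC[of "-1" x] by simp

lemma scaleC_scaleR: "c *\<^sub>C (r *\<^sub>R x) = r *\<^sub>R (c *\<^sub>C (x::'x::complex_banach))"
  by (simp add: scaleR_scaleC scaleC_scaleC mult.commute)

lemma star_scaleR: "star (r *\<^sub>R a) = r *\<^sub>R star (a::'a::cstar_algebra)"
  by (simp add: scaleR_scaleC star_scaleC)

lemma norm_star: "norm (star a) = norm (a::'a::cstar_algebra)"
proof -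
  have *: "norm b \<le> norm (star b)" for b :: 'a
  proof -
    have "norm b * norm b \<le> norm (star b) * norm b"
      using norm_mult_ineq[of "star b" b] by (simp add: norm_star_mult power2_eq_square)
    then show ?thesis by (cases "norm b = 0") auto
  qed
  show ?thesis using *[of a] *[of "star a"] by (simp add: star_star)
qed

lemma bounded_linear_star: "bounded_linear (star :: 'a::cstar_algebra \<Rightarrow> 'a)"
  by (rule bounded_linear_intro[of _ 1]) (simp_all add: star_add star_scaleR norm_star)

lemma star_simps [simp]:
  "star (0::'a::cstar_algebra) = 0" "star (- a) = - star (a::'a)" "star (a - b) = star a - star (b::'a)"
  using bounded_linear_star linear_0 linear_neg linear_diff bounded_linear.linear by blast+

lemma star_sum: "star (sum f S) = (\<Sum>i\<in>S. star (f i :: 'a::cstar_algebra))"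
  using bounded_linear_star linear_sum bounded_linear.linear by blast

declare star_star [simp]

context hilbert_module
begin

lemma ip_add_left: "ip (x + y) z = ip x z + ip y z"
  by (metis ip_add ip_star star_add)

lemma ip_scaleC_left: "ip (c *\<^sub>C x) y = cnj c *\<^sub>C ip x y"
  by (metis ip_scaleC ip_star star_scaleC)

lemma ip_scaleR: "ip x (r *\<^sub>R y) = r *\<^sub>R ip x y" "ip (r *\<^sub>R x) y = r *\<^sub>R ip x y"
  by (simp_all add: scaleR_scaleC ip_scaleC ip_scaleC_left)

lemma ip_zero [simp]: "ip x 0 = 0" "ip 0 x = 0"
  using ip_scaleR[of _ 0] by (metis scaleR_zero_left)+

lemma ip_minus: "ip x (- y) = - ip x y" "ip (- x) y = - ip x y"
  using ip_scaleR(1)[of x "-1" y] ip_scaleR(2)[of "-1" x y] by simp_all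

lemma ip_diff: "ip x (y - z) = ip x y - ip x z" "ip (x - y) z = ip x z - ip y z"
  using ip_add[of x y "- z"] ip_add_left[of x "- y" z] by (simp_all add: ip_minus)

lemma ip_eqI: "(\<And>z. ip z x = ip z y) \<Longrightarrow> x = y"
  using ip_definite[of "x - y"] by (simp add: ip_diff)

lemma norm_ip_self: "norm (ip x x) = (norm x)\<^sup>2"
  by (simp add: norm_ip)

end

text \<open>The Cauchy--Schwarz inequality holds in every Hilbert module, but its proof uses positivity in
  the algebra, which is obtained by applying this locale to the algebra as a module over itself.\<close>

locale hilbert_module_cs = hilbert_module act ip
  for act :: "'x::complex_banach \<Rightarrow> 'a::cstar_algebra \<Rightarrow> 'x" and ip :: "'x \<Rightarrow> 'x \<Rightarrow> 'a" +
  assumes norm_ip_le: "norm (ip x y) \<le> norm x * norm y"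
begin

definition adjt :: "'x endo \<Rightarrow> 'x endo \<Rightarrow> bool" where
  "adjt f g \<longleftrightarrow> (\<forall>x y. ip (app f x) y = ip x (app g y))"

lemma bounded_linear_ip_right: "bounded_linear (ip x)"
  by (rule bounded_linear_intro[of _ "norm x"])
    (simp_all add: ip_add ip_scaleR norm_ip_le mult.commute[of _ "norm x"])

lemma bounded_linear_ip_left: "bounded_linear (\<lambda>y. ip y x)"
  by (rule bounded_linear_intro[of _ "norm x"]) (simp_all add: ip_add_left ip_scaleR norm_ip_le)

end

lemma scaleC_minus_left: "(- c) *\<^sub>C x = - (c *\<^sub>C (x::'x::complex_banach))"
  using scaleC_scaleC[of "-1" c x] by (simp add: scaleC_minus_one)

definition imag_endo :: "'x::complex_banach endo" where
  "imag_endo = Endo (Blinfun (\<lambda>x. \<i> *\<^sub>C x))"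

lemma app_imag_endo: "app imag_endo x = \<i> *\<^sub>C x"
proof -
  have "bounded_linear (\<lambda>x::'a. \<i> *\<^sub>C x)"
    by (rule bounded_linear_intro[of _ 1]) (simp_all add: scaleC_add_right scaleC_scaleR norm_scaleC)
  then show ?thesis
    by (simp add: imag_endo_def app_def Endo_inverse bounded_linear_Blinfun_apply)
qed

sublocale hilbert_module_cs \<subseteq> adjoint_relation adjt imag_endo
proof
  fix f f' g g' :: "'x endo" and r :: real and F :: "nat \<Rightarrow> 'x endo"
  show "adjt g f" if "adjt f g"
    using that unfolding adjt_def by (metis ip_star)
  show "adjt (f + g) (f' + g')" if "adjt f f'" "adjt g g'"
    using that by (simp add: adjt_def ip_add ip_add_left)
  show "adjt (r *\<^sub>R f) (r *\<^sub>R f')" if "adjt f f'"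
    using that by (simp add: adjt_def ip_scaleR)
  show "adjt (f * g) (g' * f')" if "adjt f f'" "adjt g g'"
    using that by (simp add: adjt_def)
  show "adjt 1 1" by (simp add: adjt_def)
  show "adjt f f" if F: "F \<longlonglongrightarrow> f" and a: "\<And>n. adjt (F n) (F n)"
    unfolding adjt_def
  proof (intro allI)
    fix x y
    have "(\<lambda>n. ip (app (F n) x) y) \<longlonglongrightarrow> ip (app f x) y"
      by (rule bounded_linear.tendsto[OF bounded_linear_ip_left tendsto_app[OF F]])
    moreover have "(\<lambda>n. ip (app (F n) x) y) \<longlonglongrightarrow> ip x (app f y)"
      using a bounded_linear.tendsto[OF bounded_linear_ip_right tendsto_app[OF F]]
      by (simp add: adjt_def)
    ultimately show "ip (app f x) y = ip x (app f y)" by (rule LIMSEQ_unique)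
  qed
  show "(norm f)\<^sup>2 \<le> norm (g * f)" if "adjt f g"
  proof -
    have "norm f \<le> sqrt (norm (g * f))"
    proof (rule norm_endo_le)
      fix x
      have "(norm (app f x))\<^sup>2 = norm (ip x (app (g * f) x))"
        using that by (simp add: norm_ip_self[symmetric] adjt_def)
      also have "\<dots> \<le> norm x * (norm (g * f) * norm x)"
        by (rule order_trans[OF norm_ip_le mult_left_mono[OF norm_app_le]]) simp
      finally have "(norm (app f x))\<^sup>2 \<le> (sqrt (norm (g * f)) * norm x)\<^sup>2"
        by (simp add: power_mult_distrib power2_eq_square mult_ac)
      then show "norm (app f x) \<le> sqrt (norm (g * f)) * norm x"
        by (rule power2_le_imp_le) simp
    qed simp
    then have "(norm f)\<^sup>2 \<le> (sqrt (norm (g * f)))\<^sup>2" by (intro power_mono) auto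
    then show ?thesis by simp
  qed
  \<comment> \<open>Equality fails on the zero module, where the identity has norm 0.\<close>
  show "norm (1 :: 'x endo) \<le> 1" by (rule norm_endo_le) auto
  show "adjt imag_endo (- imag_endo)"
    by (simp add: adjt_def app_imag_endo ip_scaleC ip_scaleC_left ip_minus scaleC_minus_left)
  show "imag_endo * imag_endo = (- 1 :: 'x endo)"
    by (rule endo_eqI) (simp add: app_imag_endo scaleC_scaleC scaleC_minus_one)
  \<comment> \<open>Having an adjoint forces complex linearity: both sides become
    \<open>\<i> *\<^sub>C ip (app g z) x\<close> after pairing with \<open>z\<close>.\<close>
  show "imag_endo * f = f * imag_endo" if "adjt f g"
  proof (rule endo_eqI, rule ip_eqI)
    fix x z
    have fg: "ip z (app f y) = ip (app g z) y" for y
      using that unfolding adjt_def by (metis ip_star)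
    show "ip z (app (imag_endo * f) x) = ip z (app (f * imag_endo) x)"
      by (simp add: app_imag_endo ip_scaleC fg)
  qed
qed

lemma hilbert_module_alg: "hilbert_module (*) (alg_ip :: 'a::cstar_algebra \<Rightarrow> 'a \<Rightarrow> 'a)"
proof
  fix x y :: 'a
  show "positive (alg_ip x x)" by (auto simp: positive_def alg_ip_def)
  show "x = 0" if "alg_ip x x = 0" using norm_star_mult[of x] that by (simp add: alg_ip_def)
  show "norm x = sqrt (norm (alg_ip x x))" by (simp add: alg_ip_def norm_star_mult)
qed (simp_all add: alg_ip_def algebra_simps mult_scaleC_left mult_scaleC_right star_mult)

text \<open>For the algebra over itself Cauchy-Schwarz is just submultiplicativity of the norm, so
  no positivity is presupposed and there is no circularity.\<close>

interpretation alg: hilbert_module_cs "(*)" "alg_ip :: 'a::cstar_algebra \<Rightarrow> 'a \<Rightarrow> 'a"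
proof (rule hilbert_module_cs.intro[OF hilbert_module_alg], unfold_locales)
  show "norm (alg_ip x y) \<le> norm x * norm y" for x y :: 'a
    using norm_mult_ineq[of "star x" y] by (simp add: alg_ip_def norm_star)
qed

section \<open>The positive cone of a C*-algebra\<close>

text \<open>The left regular representation. It places a possibly non-unital algebra isometrically
  inside a unital one, where \<open>t *\<^sub>R 1 - left_mult a\<close> makes sense.\<close>

definition left_mult :: "'a::cstar_algebra \<Rightarrow> 'a endo" where
  "left_mult a = Endo (Blinfun ((*) a))"

lemma app_left_mult [simp]: "app (left_mult a) x = a * x"
  by (simp add: left_mult_def app_def Endo_inverse bounded_linear_Blinfun_apply bounded_linear_mult_right)

lemma left_mult_simps:
  "left_mult (a + b) = left_mult a + left_mult b" "left_mult (a - b) = left_mult a - left_mult b"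
  "left_mult (r *\<^sub>R a) = r *\<^sub>R left_mult a" "left_mult (a * b) = left_mult a * left_mult b"
  "left_mult 0 = 0"
  by (rule endo_eqI, simp add: algebra_simps)+

lemma adjt_left_mult: "alg.adjt (left_mult a) (left_mult (star a))"
  by (simp add: alg.adjt_def alg_ip_def star_mult mult.assoc)

lemma norm_left_mult: "norm (left_mult a) = norm a"
proof (rule antisym)
  show "norm (left_mult a) \<le> norm a" by (rule norm_endo_le) (auto simp: norm_mult_ineq)
  have "norm a * norm a = norm (app (left_mult a) (star a))"
    using norm_star_mult[of "star a"] by (simp add: norm_star power2_eq_square)
  also have "\<dots> \<le> norm (left_mult a) * norm a" using norm_app_le[of "left_mult a" "star a"] by (simp add: norm_star)
  finally show "norm a \<le> norm (left_mult a)" by (cases "norm a = 0") auto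
qed

text \<open>This is again the set of positive elements, in a form that makes it visibly a cone; only one
  inclusion is needed, \<open>positive_cone\<close> below.\<close>

definition cone :: "'a::cstar_algebra set" where
  "cone = {a. alg.pos (left_mult a)}"

lemma positive_cone: "positive a \<Longrightarrow> a \<in> cone"
  using alg.pos_adjt_mult[OF adjt_left_mult] by (auto simp: positive_def cone_def left_mult_simps)

lemma star_mult_cone: "star a * a \<in> cone"
  by (rule positive_cone) (auto simp: positive_def)

lemma cone_add: "a \<in> cone \<Longrightarrow> b \<in> cone \<Longrightarrow> a + b \<in> cone"
  by (simp add: cone_def left_mult_simps alg.pos_add)

lemma cone_scaleR: "a \<in> cone \<Longrightarrow> 0 \<le> r \<Longrightarrow> r *\<^sub>R a \<in> cone"
  by (simp add: cone_def left_mult_simps alg.pos_scaleR)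

lemma cone_zero: "0 \<in> cone"
  using star_mult_cone[of 0] by simp

lemma cone_sum: "(\<And>i. i \<in> S \<Longrightarrow> f i \<in> cone) \<Longrightarrow> sum f S \<in> cone"
  by (induction S rule: infinite_finite_induct) (auto intro: cone_add cone_zero)

lemma cone_norm_mono: "a \<in> cone \<Longrightarrow> b \<in> cone \<Longrightarrow> norm a \<le> norm (a + b)"
  using alg.norm_mono[of "left_mult a" "left_mult b"]
  by (simp add: cone_def norm_left_mult flip: left_mult_simps)

lemma cone_norm_mono_diff: "a \<in> cone \<Longrightarrow> b - a \<in> cone \<Longrightarrow> norm a \<le> norm b"
  using cone_norm_mono[of a "b - a"] by simp

text \<open>The operator \<open>t *\<^sub>R 1 - left_mult p\<close> has a root \<open>m\<close>,
  possibly not a left multiplication. Still \<open>app m a\<close> lies in the algebra, and the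
  difference is \<open>star (app m a) * app m a\<close>.\<close>

lemma cone_conjugate_bound:
  assumes "p \<in> cone" "norm p \<le> t"
  shows "t *\<^sub>R (star a * a) - star a * p * a \<in> cone"
proof -
  have "alg.pos (t *\<^sub>R 1 - left_mult p)"
    using assms by (intro alg.pos_diff_of_norm_le alg.pos_selfadj) (auto simp: cone_def norm_left_mult)
  then obtain m where m: "alg.pos m" "m * m = t *\<^sub>R 1 - left_mult p"
    by (rule alg.pos_sqrt) blast
  have "star (app m a) * app m a = star a * app (m * m) a"
    using alg.pos_selfadj[OF m(1)] by (simp add: alg.adjt_def alg_ip_def)
  also have "\<dots> = t *\<^sub>R (star a * a) - star a * p * a"
    unfolding m(2) by (simp add: algebra_simps)
  finally show ?thesis using star_mult_cone by metis
qed

text \<open>Cauchy--Schwarz for the matrix with entries \<open>p\<close>, \<open>q\<close>, \<open>s\<close>; the witness is \<open>a = q / t\<close> for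
  \<open>t\<close> slightly larger than \<open>\<parallel>p\<parallel>\<close>.\<close>

lemma cone_cauchy_schwarz:
  fixes p q s :: "'a::cstar_algebra"
  assumes p: "p \<in> cone"
    and c: "\<And>a. star a * p * a - star a * q - star q * a + s \<in> cone"
  shows "(norm q)\<^sup>2 \<le> norm p * norm s"
proof -
  have *: "(norm q)\<^sup>2 \<le> t * norm s" if t: "norm p < t" for t
  proof -
    have t0: "0 < t" using t norm_ge_zero le_less_trans by blast
    let ?a = "(1/t) *\<^sub>R q"
    have 1: "t *\<^sub>R (star ?a * ?a) - star ?a * p * ?a \<in> cone"
      using p t by (intro cone_conjugate_bound) auto
    have "t *\<^sub>R (star ?a * ?a) = (1/t) *\<^sub>R (star q * q)"
      "star ?a * q = (1/t) *\<^sub>R (star q * q)" "star q * ?a = (1/t) *\<^sub>R (star q * q)"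
      using t0 by (simp_all add: star_scaleR)
    moreover have "t *\<^sub>R (star ?a * ?a) - star ?a * p * ?a
        + (star ?a * p * ?a - star ?a * q - star q * ?a + s)
      = t *\<^sub>R (star ?a * ?a) - star ?a * q - star q * ?a + s"
      by (simp only: algebra_simps)
    ultimately have "s - (1/t) *\<^sub>R (star q * q) \<in> cone"
      using cone_add[OF 1 c[of ?a]] by (simp only:) (simp add: algebra_simps)
    then have "norm ((1/t) *\<^sub>R (star q * q)) \<le> norm s"
      using t0 by (intro cone_norm_mono_diff cone_scaleR star_mult_cone) auto
    then show ?thesis using t0 by (simp add: norm_star_mult divide_simps mult.commute)
  qed
  show ?thesis
  proof (cases "norm s = 0")
    case True
    then show ?thesis using *[of "norm p + 1"] by simp
  next
    case False
    then have s: "norm s > 0" by simp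
    have "(norm q)\<^sup>2 / norm s \<le> t" if "norm p < t" for t
      using *[OF that] s by (simp add: divide_simps)
    then have "(norm q)\<^sup>2 / norm s \<le> norm p" by (rule dense_ge)
    then show ?thesis using s by (simp add: divide_simps)
  qed
qed

text \<open>Expanding the sum of \<open>star (a i * c - b i) * (a i * c - b i)\<close> gives the
  hypothesis of \<open>cone_cauchy_schwarz\<close> for every \<open>c\<close>.\<close>

lemma sum_cauchy_schwarz:
  fixes a b :: "'i \<Rightarrow> 'a::cstar_algebra"
  shows "(norm (\<Sum>i\<in>S. star (a i) * b i))\<^sup>2 \<le>
    norm (\<Sum>i\<in>S. star (a i) * a i) * norm (\<Sum>i\<in>S. star (b i) * b i)"
proof (rule cone_cauchy_schwarz)
  show "(\<Sum>i\<in>S. star (a i) * a i) \<in> cone" by (intro cone_sum star_mult_cone)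
  fix c
  have "(\<Sum>i\<in>S. star (a i * c - b i) * (a i * c - b i)) \<in> cone" by (intro cone_sum star_mult_cone)
  then show "star c * (\<Sum>i\<in>S. star (a i) * a i) * c - star c * (\<Sum>i\<in>S. star (a i) * b i)
      - star (\<Sum>i\<in>S. star (a i) * b i) * c + (\<Sum>i\<in>S. star (b i) * b i) \<in> cone"
    by (simp add: star_mult star_sum sum_distrib_left sum_distrib_right sum.distrib sum_subtractf algebra_simps)
qed

context hilbert_module
begin

lemma ip_cone: "ip x x \<in> cone"
  by (rule positive_cone[OF ip_positive])

lemma cauchy_schwarz: "norm (ip x y) \<le> norm x * norm y"
proof -
  have "(norm (ip x y))\<^sup>2 \<le> norm (ip x x) * norm (ip y y)"
  proof (rule cone_cauchy_schwarz[OF ip_cone])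
    fix a
    show "star a * ip x x * a - star a * ip x y - star (ip x y) * a + ip y y \<in> cone"
      using ip_cone[of "act x a - y"] by (simp add: ip_diff ip_act ip_act_left ip_star algebra_simps)
  qed
  also have "\<dots> = (norm x * norm y)\<^sup>2" by (simp add: norm_ip_self power_mult_distrib)
  finally show ?thesis by (rule power2_le_imp_le) simp
qed

end

sublocale hilbert_module \<subseteq> hilbert_module_cs
  by unfold_locales (rule cauchy_schwarz)

context hilbert_module
begin

lemma selfadj_app: "selfadj f \<Longrightarrow> ip (app f x) y = ip x (app f y)"
  by (simp add: adjt_def)

lemma pos_ip:
  assumes "pos f"
  shows "positive (ip x (app f x))"
proof -
  obtain r where r: "pos r" "r * r = f" using pos_sqrt[OF assms] by blast
  have "ip x (app f x) = ip (app r x) (app r x)"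
    unfolding r(2)[symmetric] by (simp add: selfadj_app[OF pos_selfadj[OF r(1)]])
  then show ?thesis using ip_positive by simp
qed

text \<open>The form \<open>ip x (app T y)\<close> is positive semidefinite, so it obeys its own
  Cauchy-Schwarz inequality. With \<open>y = app T x\<close> it bounds the fourth power of
  \<open>norm y\<close> by \<open>(t * norm x)\<^sup>2 * (norm y)\<^sup>2\<close>, and a factor
  cancels.\<close>

lemma norm_le_of_ip_bounds:
  assumes T: "selfadj T" and t: "0 \<le> t"
    and lower: "\<And>x. ip x (app T x) \<in> cone" and upper: "\<And>x. t *\<^sub>R ip x x - ip x (app T x) \<in> cone"
  shows "norm T \<le> t"
proof (rule norm_endo_le[OF t])
  fix x
  have cs: "(norm (ip x (app T y)))\<^sup>2 \<le> norm (ip x (app T x)) * norm (ip y (app T y))" for x y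
  proof (rule cone_cauchy_schwarz[OF lower])
    fix a
    have "star (ip x (app T y)) = ip y (app T x)" by (simp add: ip_star selfadj_app[OF T])
    moreover have "ip (act z a) (app T w) = star a * ip z (app T w)" for z w by (rule ip_act_left)
    moreover have "ip z (app T (act w a)) = ip z (app T w) * a" for z w
      by (simp only: selfadj_app[OF T, symmetric] ip_act)
    ultimately show "star a * ip x (app T x) * a - star a * ip x (app T y)
        - star (ip x (app T y)) * a + ip y (app T y) \<in> cone"
      using lower[of "act x a - y"] by (simp add: ip_diff algebra_simps)
  qed
  have b: "norm (ip x (app T x)) \<le> t * (norm x)\<^sup>2" for x
    using cone_norm_mono_diff[OF lower upper, of x] t by (simp add: norm_ip_self)
  let ?y = "app T x"
  have "((norm ?y)\<^sup>2)\<^sup>2 = (norm (ip x (app T ?y)))\<^sup>2"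
    by (simp only: selfadj_app[OF T, of x ?y, symmetric] norm_ip_self)
  also have "\<dots> \<le> norm (ip x (app T x)) * norm (ip ?y (app T ?y))" by (rule cs)
  also have "\<dots> \<le> (t * (norm x)\<^sup>2) * (t * (norm ?y)\<^sup>2)"
    by (rule mult_mono[OF b b]) (use t in auto)
  also have "\<dots> = (t * norm x)\<^sup>2 * (norm ?y)\<^sup>2" by (simp add: power_mult_distrib power2_eq_square)
  finally have *: "(norm ?y)\<^sup>2 * (norm ?y)\<^sup>2 \<le> (t * norm x)\<^sup>2 * (norm ?y)\<^sup>2"
    by (simp only: power2_eq_square)
  show "norm ?y \<le> t * norm x"
  proof (cases "norm ?y = 0")
    case True
    then show ?thesis using t by simp
  next
    case False
    then have "0 < (norm ?y)\<^sup>2" by simp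
    with * have "(norm ?y)\<^sup>2 \<le> (t * norm x)\<^sup>2" by (rule mult_right_le_imp_le)
    then show ?thesis by (rule power2_le_imp_le) (use t in simp)
  qed
qed

lemma bounded_by_norm:
  assumes "selfadj T" "norm T \<le> t"
  shows "positive (t *\<^sub>R ip x x - ip x (app T x))"
  using pos_ip[OF pos_diff_of_norm_le[OF assms], of x] by (simp add: ip_diff ip_scaleR)

end

section \<open>Square summable sequences\<close>

lemma l2_summable: "a \<in> l2 \<Longrightarrow> summable (\<lambda>n. star (a n) * a n)"
  by (simp add: l2_def)

lemma l2_summable_mult:
  assumes "a \<in> l2" "b \<in> l2"
  shows "summable (\<lambda>n. star (a n) * b n)"
  unfolding summable_Cauchy
proof (intro allI impI)
  fix e :: real assume e: "e > 0"
  obtain M where M: "\<And>m n. m \<ge> M \<Longrightarrow> norm (\<Sum>i=m..<n. star (a i) * a i) < e"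
    using l2_summable[OF assms(1)] e unfolding summable_Cauchy by blast
  obtain N where N: "\<And>m n. m \<ge> N \<Longrightarrow> norm (\<Sum>i=m..<n. star (b i) * b i) < e"
    using l2_summable[OF assms(2)] e unfolding summable_Cauchy by blast
  have "norm (\<Sum>i=m..<n. star (a i) * b i) < e" if m: "m \<ge> max M N" for m n
  proof -
    have "(norm (\<Sum>i=m..<n. star (a i) * b i))\<^sup>2
        \<le> norm (\<Sum>i=m..<n. star (a i) * a i) * norm (\<Sum>i=m..<n. star (b i) * b i)"
      by (rule sum_cauchy_schwarz)
    also have "\<dots> < e * e"
      by (rule mult_strict_mono) (use M[of m n] N[of m n] m e in auto)
    finally have "(norm (\<Sum>i=m..<n. star (a i) * b i))\<^sup>2 < e\<^sup>2" by (simp only: power2_eq_square)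
    then show ?thesis by (rule power2_less_imp_less) (use e in simp)
  qed
  then show "\<exists>N. \<forall>m\<ge>N. \<forall>n. norm (\<Sum>i=m..<n. star (a i) * b i) < e" by blast
qed

lemma l2_add:
  assumes "a \<in> l2" "b \<in> l2"
  shows "(\<lambda>n. a n + b n) \<in> l2"
    and "l2_ip (\<lambda>n. a n + b n) (\<lambda>n. a n + b n) =
      l2_ip a a + l2_ip a b + l2_ip b a + l2_ip b b"
proof -
  have s: "summable (\<lambda>n. star (a n) * a n)" "summable (\<lambda>n. star (a n) * b n)"
    "summable (\<lambda>n. star (b n) * a n)" "summable (\<lambda>n. star (b n) * b n)"
    using assms by (auto intro: l2_summable_mult)
  have eq: "(\<lambda>n. star (a n + b n) * (a n + b n)) =
      (\<lambda>n. star (a n) * a n + star (a n) * b n + star (b n) * a n + star (b n) * b n)"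
    by (simp add: star_add algebra_simps)
  show "(\<lambda>n. a n + b n) \<in> l2"
    unfolding l2_def mem_Collect_eq eq by (intro summable_add s)
  show "l2_ip (\<lambda>n. a n + b n) (\<lambda>n. a n + b n) =
      l2_ip a a + l2_ip a b + l2_ip b a + l2_ip b b"
    unfolding l2_ip_def eq by (simp add: suminf_add s summable_add)
qed

lemma l2_scaleR:
  assumes "a \<in> l2"
  shows "(\<lambda>n. r *\<^sub>R a n) \<in> l2"
    and "l2_ip (\<lambda>n. r *\<^sub>R a n) (\<lambda>n. r *\<^sub>R a n) = r\<^sup>2 *\<^sub>R l2_ip a a"
  using summable_scaleR_right[OF l2_summable[OF assms], of "r\<^sup>2"]
    suminf_scaleR_right[OF l2_summable[OF assms], of "r\<^sup>2"]
  by (simp_all add: l2_def l2_ip_def star_scaleR power2_eq_square)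

lemma l2_diff:
  assumes "a \<in> l2" "b \<in> l2"
  shows "(\<lambda>n. a n - b n) \<in> l2"
  using l2_add(1)[OF assms(1) l2_scaleR(1)[OF assms(2), of "-1"]] by simp

lemma l2_norm_nonneg [simp]: "0 \<le> l2_norm a"
  by (simp add: l2_norm_def)

lemma l2_norm_square: "(l2_norm a)\<^sup>2 = norm (l2_ip a a)"
  by (simp add: l2_norm_def)

lemma l2_norm_scaleR: "a \<in> l2 \<Longrightarrow> l2_norm (\<lambda>n. r *\<^sub>R a n) = \<bar>r\<bar> * l2_norm a"
  by (simp add: l2_norm_def l2_scaleR(2) real_sqrt_mult)

lemma l2_ip_tendsto:
  assumes "a \<in> l2" "b \<in> l2"
  shows "(\<lambda>n. \<Sum>i<n. star (a i) * b i) \<longlonglongrightarrow> l2_ip a b"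
  unfolding l2_ip_def by (rule summable_LIMSEQ[OF l2_summable_mult[OF assms]])

lemma l2_cauchy_schwarz:
  assumes "a \<in> l2" "b \<in> l2"
  shows "norm (l2_ip a b) \<le> l2_norm a * l2_norm b"
proof -
  have "(norm (l2_ip a b))\<^sup>2 \<le> norm (l2_ip a a) * norm (l2_ip b b)"
    by (rule LIMSEQ_le[OF tendsto_power[OF tendsto_norm[OF l2_ip_tendsto[OF assms]]]
      tendsto_mult[OF tendsto_norm[OF l2_ip_tendsto[OF assms(1) assms(1)]]
        tendsto_norm[OF l2_ip_tendsto[OF assms(2) assms(2)]]]])
      (simp add: sum_cauchy_schwarz)
  also have "\<dots> = (l2_norm a * l2_norm b)\<^sup>2" by (simp add: power_mult_distrib l2_norm_square)
  finally show ?thesis by (rule power2_le_imp_le) simp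
qed

lemma l2_norm_triangle:
  assumes "a \<in> l2" "b \<in> l2"
  shows "l2_norm (\<lambda>n. a n + b n) \<le> l2_norm a + l2_norm b"
proof -
  have "(l2_norm (\<lambda>n. a n + b n))\<^sup>2 \<le>
      norm (l2_ip a a) + norm (l2_ip a b) + norm (l2_ip b a) + norm (l2_ip b b)"
    unfolding l2_norm_square l2_add(2)[OF assms]
    by (rule norm_triangle_le[OF add_right_mono[OF norm_triangle_le[OF add_right_mono[OF norm_triangle_ineq]]]])
  also have "\<dots> \<le> (l2_norm a)\<^sup>2 + l2_norm a * l2_norm b + l2_norm b * l2_norm a + (l2_norm b)\<^sup>2"
    by (intro add_mono l2_cauchy_schwarz assms) (simp_all add: l2_norm_square)
  also have "\<dots> = (l2_norm a + l2_norm b)\<^sup>2" by (simp add: power2_eq_square algebra_simps)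
  finally show ?thesis by (rule power2_le_imp_le) simp
qed

lemma l2_norm_triangle_diff:
  assumes "a \<in> l2" "b \<in> l2"
  shows "l2_norm a \<le> l2_norm (\<lambda>n. a n - b n) + l2_norm b"
    and "l2_norm b \<le> l2_norm (\<lambda>n. a n - b n) + l2_norm a"
proof -
  have d: "(\<lambda>n. a n - b n) \<in> l2" "(\<lambda>n. b n - a n) \<in> l2" by (intro l2_diff assms)+
  have "l2_norm (\<lambda>n. b n - a n) = l2_norm (\<lambda>n. a n - b n)"
    using l2_norm_scaleR[OF d(1), of "-1"] by simp
  then show "l2_norm a \<le> l2_norm (\<lambda>n. a n - b n) + l2_norm b"
    and "l2_norm b \<le> l2_norm (\<lambda>n. a n - b n) + l2_norm a"
    using l2_norm_triangle[OF d(1) assms(2)] l2_norm_triangle[OF d(2) assms(1)] by simp_all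
qed

lemma norm_partial_sum_le:
  assumes "a \<in> l2"
  shows "norm (\<Sum>i=m..<n. star (a i) * a i) \<le> (l2_norm a)\<^sup>2"
  unfolding l2_norm_square
proof (rule LIMSEQ_le_const[OF tendsto_norm[OF l2_ip_tendsto[OF assms assms]]], intro exI allI impI)
  fix k assume "n \<le> k"
  then have sub: "{m..<n} \<subseteq> {..<k}" by auto
  have "(\<Sum>i<k. star (a i) * a i) = (\<Sum>i\<in>{..<k} - {m..<n}. star (a i) * a i) + (\<Sum>i=m..<n. star (a i) * a i)"
    by (rule sum.subset_diff[OF sub]) simp
  then show "norm (\<Sum>i=m..<n. star (a i) * a i) \<le> norm (\<Sum>i<k. star (a i) * a i)"
    by (intro cone_norm_mono_diff cone_sum star_mult_cone) (simp add: cone_sum star_mult_cone)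
qed

section \<open>Multipliers\<close>

context hilbert_module
begin

lemma ip_multiplier:
  assumes "v \<in> multiplier_module ip"
  shows "ip x (v a) = star (mult_ip ip v x) * a"
  by (metis assms ip_star mult_ip_adjoint star_mult star_star)

lemma mult_ip_eqI:
  assumes "v \<in> multiplier_module ip" "\<And>a. ip (v a) x = star a * b"
  shows "mult_ip ip v x = b"
  by (rule alg_ip_nondegenerate) (simp add: alg_ip_def assms flip: mult_ip_adjoint[OF assms(1)])

lemma mult_ip_scaleR:
  assumes "v \<in> multiplier_module ip"
  shows "mult_ip ip v (r *\<^sub>R x) = r *\<^sub>R mult_ip ip v x"
  by (rule mult_ip_eqI[OF assms]) (simp add: ip_scaleR mult_ip_adjoint[OF assms])

lemma mult_ip_diff:
  assumes "v \<in> multiplier_module ip"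
  shows "mult_ip ip v (x - y) = mult_ip ip v x - mult_ip ip v y"
  by (rule mult_ip_eqI[OF assms]) (simp add: ip_diff mult_ip_adjoint[OF assms] right_diff_distrib)

text \<open>Frames and outer frames are complementary cases among multiplier sequences with bounds,
  so both are treated together from here on.\<close>

lemma frame_or_outer_frame_iff:
  "frame act ip v \<or> outer_frame act ip v \<longleftrightarrow>
    (\<forall>n. v n \<in> multiplier_module ip) \<and> (\<exists>A B. frame_bounds ip v A B)"
proof -
  have "range (embed act) \<subseteq> multiplier_module ip" using embed_in_multiplier_module by auto
  then show ?thesis unfolding frame_def outer_frame_def by blast
qed

end

section \<open>The frame operator and its square root\<close>

lemma summable_of_partial_sums_bound:
  fixes f :: "nat \<Rightarrow> 'b::banach" and g :: "nat \<Rightarrow> 'c::banach"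
  assumes g: "summable g" and C: "0 \<le> C"
    and le: "\<And>m n. (norm (\<Sum>i=m..<n. f i))\<^sup>2 \<le> C * norm (\<Sum>i=m..<n. g i)"
  shows "summable f"
  unfolding summable_Cauchy
proof (intro allI impI)
  fix e :: real assume e: "e > 0"
  \<comment> \<open>Dividing by \<open>C + 1\<close> covers the case \<open>C = 0\<close>.\<close>
  then have "e\<^sup>2 / (C + 1) > 0" using C by simp
  then obtain N where N: "\<And>m n. m \<ge> N \<Longrightarrow> norm (\<Sum>i=m..<n. g i) < e\<^sup>2 / (C + 1)"
    using g unfolding summable_Cauchy by blast
  have "norm (\<Sum>i=m..<n. f i) < e" if "m \<ge> N" for m n
  proof -
    have "(norm (\<Sum>i=m..<n. f i))\<^sup>2 \<le> (C + 1) * norm (\<Sum>i=m..<n. g i)"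
      by (rule order_trans[OF le mult_right_mono]) auto
    also have "\<dots> < (C + 1) * (e\<^sup>2 / (C + 1))"
      by (rule mult_strict_left_mono[OF N[OF that]]) (use C in simp)
    also have "\<dots> = e\<^sup>2" using C by simp
    finally show ?thesis by (rule power2_less_imp_less) (use e in simp)
  qed
  then show "\<exists>N. \<forall>m\<ge>N. \<forall>n. norm (\<Sum>i=m..<n. f i) < e" by blast
qed

locale frame_sequence = hilbert_module act ip
  for act :: "'x::complex_banach \<Rightarrow> 'a::cstar_algebra \<Rightarrow> 'x" and ip :: "'x \<Rightarrow> 'x \<Rightarrow> 'a" +
  fixes v :: "nat \<Rightarrow> 'a \<Rightarrow> 'x" and A B :: real
  assumes v_multiplier: "v n \<in> multiplier_module ip"
    and bounds: "frame_bounds ip v A B"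
begin

abbreviation U :: "'x \<Rightarrow> nat \<Rightarrow> 'a" where
  "U \<equiv> analysis ip v"

lemma A_pos: "0 < A" and B_pos: "0 < B"
  using bounds by (auto simp: frame_bounds_def)

lemma U_l2: "U x \<in> l2"
  using bounds by (auto simp: frame_bounds_def l2_def analysis_def)

lemma U_lower: "l2_ip (U x) (U x) - A *\<^sub>R ip x x \<in> cone"
  and U_upper: "B *\<^sub>R ip x x - l2_ip (U x) (U x) \<in> cone"
  using bounds by (auto simp: frame_bounds_def l2_ip_def analysis_def cstar_le_def intro: positive_cone)

lemma l2_ip_cone: "l2_ip (U x) (U x) \<in> cone"
proof -
  have "A *\<^sub>R ip x x \<in> cone" using A_pos by (intro cone_scaleR ip_cone) simp
  from cone_add[OF U_lower[of x] this] show ?thesis by simp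
qed

lemma U_diff: "U (x - y) = (\<lambda>n. U x n - U y n)"
  by (simp add: analysis_def mult_ip_diff[OF v_multiplier])

lemma U_scaleR: "U (r *\<^sub>R x) = (\<lambda>n. r *\<^sub>R U x n)"
  by (simp add: analysis_def mult_ip_scaleR[OF v_multiplier])

lemma U_norm: "l2_norm (U x) \<le> sqrt B * norm x"
proof -
  have "norm (l2_ip (U x) (U x)) \<le> norm (B *\<^sub>R ip x x)"
    by (rule cone_norm_mono_diff[OF l2_ip_cone U_upper])
  also have "\<dots> = (sqrt B * norm x)\<^sup>2" using B_pos by (simp add: norm_ip_self power_mult_distrib)
  finally have "(l2_norm (U x))\<^sup>2 \<le> (sqrt B * norm x)\<^sup>2" by (simp only: l2_norm_square)
  then show ?thesis by (rule power2_le_imp_le) (use B_pos in simp)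
qed

text \<open>For a block \<open>z\<close> of the series, \<open>ip z z\<close> is the pairing of
  \<open>U z\<close> with the same block of \<open>a\<close>. Cauchy-Schwarz and the upper frame
  bound then leave a factor \<open>(norm z)\<^sup>2\<close> on both sides to cancel.\<close>

lemma synthesis_summable:
  assumes a: "a \<in> l2"
  shows "summable (\<lambda>n. v n (a n))"
proof (rule summable_of_partial_sums_bound[OF l2_summable[OF a]])
  fix m n
  define z where "z = (\<Sum>i=m..<n. v i (a i))"
  have "ip z z = (\<Sum>i=m..<n. star (U z i) * a i)"
    unfolding analysis_def ip_multiplier[OF v_multiplier, symmetric] z_def
    by (rule linear_sum[OF bounded_linear.linear[OF bounded_linear_ip_right]])
  then have "norm (\<Sum>i=m..<n. star (U z i) * a i) = (norm z)\<^sup>2" by (simp only: norm_ip_self[symmetric])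
  then have "((norm z)\<^sup>2)\<^sup>2 \<le> norm (\<Sum>i=m..<n. star (U z i) * U z i) * norm (\<Sum>i=m..<n. star (a i) * a i)"
    using sum_cauchy_schwarz[of "U z" a "{m..<n}"] by (simp only:)
  also have "\<dots> \<le> (sqrt B * norm z)\<^sup>2 * norm (\<Sum>i=m..<n. star (a i) * a i)"
    by (rule mult_right_mono[OF order_trans[OF norm_partial_sum_le[OF U_l2] power_mono[OF U_norm]]]) simp_all
  also have "\<dots> = (B * norm (\<Sum>i=m..<n. star (a i) * a i)) * (norm z)\<^sup>2"
    using B_pos by (simp add: power_mult_distrib)
  finally have *: "(norm z)\<^sup>2 * (norm z)\<^sup>2 \<le> (B * norm (\<Sum>i=m..<n. star (a i) * a i)) * (norm z)\<^sup>2"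
    by (simp only: power2_eq_square)
  show "(norm (\<Sum>i=m..<n. v i (a i)))\<^sup>2 \<le> B * norm (\<Sum>i=m..<n. star (a i) * a i)"
  proof (cases "z = 0")
    case True
    then show ?thesis using B_pos by (simp flip: z_def)
  next
    case False
    then have "0 < (norm z)\<^sup>2" by simp
    with * show ?thesis unfolding z_def[symmetric] by (rule mult_right_le_imp_le)
  qed
qed (use B_pos in simp)

lemma is_adjoint_synthesis: "is_adjoint UNIV ip l2 l2_ip U (\<lambda>a. \<Sum>n. v n (a n))"
proof -
  have "l2_ip (U x) a = ip x (\<Sum>n. v n (a n))" if a: "a \<in> l2" for x a
  proof -
    have "(\<lambda>n. ip x (v n (a n))) sums ip x (\<Sum>n. v n (a n))"
      by (rule bounded_linear.sums[OF bounded_linear_ip_right summable_sums[OF synthesis_summable[OF a]]])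
    then show ?thesis
      by (simp add: l2_ip_def analysis_def sums_iff ip_multiplier[OF v_multiplier])
  qed
  then show ?thesis by (auto simp: is_adjoint_def U_l2)
qed

text \<open>\<open>Blinfun\<close> returns the intended operator only for a bounded linear argument;
  \<open>app_frame_op\<close> establishes this for the composite.\<close>

definition frame_op :: "'x endo" where
  "frame_op = Endo (Blinfun (adj UNIV ip l2 l2_ip U \<circ> U))"

text \<open>The choice made by \<open>adj\<close> is arbitrary outside \<open>l2\<close>, but
  composed with \<open>U\<close> it is evaluated only on \<open>l2\<close>, where the adjoint
  equation fixes it.\<close>

lemma ip_adj_U: "ip x ((adj UNIV ip l2 l2_ip U \<circ> U) y) = l2_ip (U x) (U y)"
proof -
  have "is_adjoint UNIV ip l2 l2_ip U (adj UNIV ip l2 l2_ip U)"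
    unfolding adj_def by (rule someI[of "is_adjoint UNIV ip l2 l2_ip U", OF is_adjoint_synthesis])
  then show ?thesis by (simp add: is_adjoint_def U_l2)
qed

end

text \<open>Symmetry yields linearity because the inner product separates points. This brings bare
  functions, such as a competing square root, into the operator algebra.\<close>

lemma (in hilbert_module) symmetric_endo:
  assumes sym: "\<And>x y. ip (f x) y = ip x (f y)" and bd: "\<And>x. norm (f x) \<le> C * norm x"
  obtains F where "selfadj F" "\<And>x. app F x = f x"
proof -
  have "bounded_linear f"
  proof (rule bounded_linear_intro[of _ C])
    show "f (x + y) = f x + f y" for x y
      by (rule ip_eqI) (simp add: ip_add flip: sym)
    show "f (r *\<^sub>R x) = r *\<^sub>R f x" for r x
      by (rule ip_eqI) (simp add: ip_scaleR flip: sym)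
  qed (simp add: bd mult.commute)
  then obtain F where F: "\<And>x. app F x = f x" by (rule ex_endo) blast
  have "selfadj F" by (simp add: adjt_def F sym)
  with F show ?thesis by (rule that[rotated])
qed

context frame_sequence
begin

lemma app_frame_op: "app frame_op = adj UNIV ip l2 l2_ip U \<circ> U"
  and selfadj_frame_op: "selfadj frame_op"
proof -
  let ?f = "adj UNIV ip l2 l2_ip U \<circ> U"
  have star_l2: "star (l2_ip (U x) (U y)) = l2_ip (U y) (U x)" for x y
    unfolding l2_ip_def
    by (subst bounded_linear.suminf[OF bounded_linear_star l2_summable_mult[OF U_l2 U_l2]])
      (simp add: star_mult)
  have sym: "ip (?f x) y = ip x (?f y)" for x y
    by (metis ip_adj_U ip_star star_l2)
  have bd: "norm (?f x) \<le> B * norm x" for x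
  proof -
    let ?y = "?f x"
    have "norm ?y * norm ?y = norm (l2_ip (U ?y) (U x))"
      by (simp only: ip_adj_U[symmetric] norm_ip_self power2_eq_square)
    also have "\<dots> \<le> l2_norm (U ?y) * l2_norm (U x)" by (rule l2_cauchy_schwarz[OF U_l2 U_l2])
    also have "\<dots> \<le> (sqrt B * norm ?y) * (sqrt B * norm x)"
      by (rule mult_mono[OF U_norm U_norm]) (use B_pos in auto)
    also have "\<dots> = norm ?y * (B * norm x)" using B_pos by simp
    finally have *: "norm ?y * norm ?y \<le> norm ?y * (B * norm x)" .
    show ?thesis
    proof (cases "norm ?y = 0")
      case True then show ?thesis using B_pos by simp
    next
      case False then have "0 < norm ?y" by simp
      with * show ?thesis by (rule mult_left_le_imp_le)
    qed
  qed
  obtain F where F: "selfadj F" "\<And>x. app F x = ?f x" using symmetric_endo[OF sym bd] by blast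
  then have "app F = ?f" by (intro ext) blast
  then have "bounded_linear ?f" using bounded_linear_app[of F] by (simp only:)
  then show *: "app frame_op = ?f"
    by (simp add: frame_op_def app_def fun_eq_iff Endo_inverse bounded_linear_Blinfun_apply)
  show "selfadj frame_op" unfolding adjt_def * using sym by blast
qed

lemma ip_frame_op: "ip x (app frame_op y) = l2_ip (U x) (U y)"
  unfolding app_frame_op by (rule ip_adj_U)

end

context hilbert_module
begin

lemma adj_selfadj:
  assumes "selfadj R"
  shows "adj UNIV ip UNIV ip (app R) = app R"
proof -
  let ?P = "is_adjoint UNIV ip UNIV ip (app R)"
  have "?P (app R)" using selfadj_app[OF assms] by (simp add: is_adjoint_def)
  then have "?P (adj UNIV ip UNIV ip (app R))" unfolding adj_def by (rule someI[of ?P])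
  then have "ip x (adj UNIV ip UNIV ip (app R) y) = ip x (app R y)" for x y
    by (simp add: is_adjoint_def flip: selfadj_app[OF assms])
  then show ?thesis by (intro ext ip_eqI)
qed

lemma pos_positive_op:
  assumes "pos S"
  shows "positive_op ip (app S)"
proof -
  obtain R where R: "pos R" "R * R = S" using pos_sqrt[OF assms] by blast
  have "adjointable UNIV ip UNIV ip (app R)"
    unfolding adjointable_def is_adjoint_def
    using selfadj_app[OF pos_selfadj[OF R(1)]] by auto
  moreover have "app S = adj UNIV ip UNIV ip (app R) \<circ> app R"
    unfolding adj_selfadj[OF pos_selfadj[OF R(1)]] by (auto simp flip: R(2))
  ultimately show ?thesis unfolding positive_op_def by blast
qed

lemma positive_op_ip:
  assumes "positive_op ip Q"
  shows "ip (Q x) y = ip x (Q y)" and "ip x (Q x) \<in> cone"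
proof -
  obtain R where R: "adjointable UNIV ip UNIV ip R" "Q = adj UNIV ip UNIV ip R \<circ> R"
    using assms by (auto simp: positive_op_def)
  have "is_adjoint UNIV ip UNIV ip R (adj UNIV ip UNIV ip R)"
    using R(1) unfolding adjointable_def adj_def by (rule someI_ex)
  then have *: "ip x (Q y) = ip (R x) (R y)" for x y by (simp add: is_adjoint_def R(2))
  show "ip x (Q x) \<in> cone" unfolding * by (rule ip_cone)
  show "ip (Q x) y = ip x (Q y)" by (metis * ip_star)
qed

text \<open>Uniqueness: any other positive root \<open>Q\<close> commutes with \<open>S\<^sup>2\<close>, hence with \<open>S\<close>, and then
  \<open>y = (S - Q) x\<close> satisfies \<open>\<langle>y, S y\<rangle> + \<langle>y, Q y\<rangle> = 0\<close> with both terms positive.\<close>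

lemma op_sqrt_eq:
  assumes S: "pos S" and inj: "inj (app S)"
    and comm: "\<And>z. z * (S * S) = (S * S) * z \<Longrightarrow> z * S = S * z"
  shows "op_sqrt ip (app (S * S)) = app S"
  unfolding op_sqrt_def
proof (rule the_equality)
  show "positive_op ip (app S) \<and> app S \<circ> app S = app (S * S)"
    using pos_positive_op[OF S] by auto
next
  fix Q assume Q: "positive_op ip Q \<and> Q \<circ> Q = app (S * S)"
  then have QQ: "Q (Q x) = app (S * S) x" for x by (metis comp_apply)
  note sym = positive_op_ip(1)[OF conjunct1[OF Q]]
  have bd: "norm (Q x) \<le> sqrt (norm (S * S)) * norm x" for x
  proof -
    have "(norm (Q x))\<^sup>2 = norm (ip x (app (S * S) x))" by (simp only: norm_ip_self[symmetric] sym QQ)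
    also have "\<dots> \<le> norm x * (norm (S * S) * norm x)"
      by (rule order_trans[OF norm_ip_le mult_left_mono[OF norm_app_le]]) simp
    also have "\<dots> = (sqrt (norm (S * S)) * norm x)\<^sup>2" by (simp add: power_mult_distrib power2_eq_square)
    finally show ?thesis by (rule power2_le_imp_le) simp
  qed
  obtain q where q: "selfadj q" "\<And>x. app q x = Q x" using symmetric_endo[OF sym bd] by blast
  have qq: "q * q = S * S" by (rule endo_eqI) (simp add: q(2) QQ)
  have "q * (S * S) = (S * S) * q" unfolding qq[symmetric] by (simp add: mult.assoc)
  then have qS: "q * S = S * q" by (rule comm)
  have "app S x = app q x" for x
  proof -
    define y where "y = app (S - q) x"
    have "(S + q) * (S - q) = 0" using qS qq by (simp add: algebra_simps)
    then have "app (S + q) y = 0" unfolding y_def by (metis app_simps(4) app_simps(6))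
    then have "ip y (app S y) + ip y (Q y) = 0" by (metis app_simps(1) q(2) ip_add ip_zero(1))
    moreover have "ip y (app S y) \<in> cone" by (rule positive_cone[OF pos_ip[OF S]])
    moreover have "ip y (Q y) \<in> cone" by (rule positive_op_ip(2)[OF conjunct1[OF Q]])
    ultimately have "norm (ip y (app S y)) \<le> norm (0::'a)" by (metis cone_norm_mono)
    then have 0: "ip y (app S y) = 0" by simp
    obtain r where r: "pos r" "r * r = S" using pos_sqrt[OF S] by blast
    have "ip (app r y) (app r y) = 0"
      using 0 unfolding r(2)[symmetric] by (simp add: selfadj_app[OF pos_selfadj[OF r(1)]])
    then have "app r y = 0" by (rule ip_definite)
    then have "app S y = app S 0" unfolding r(2)[symmetric] by simp
    then have "y = 0" by (rule injD[OF inj])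
    then show ?thesis by (simp add: y_def)
  qed
  then show "Q = app S" using q(2) by auto
qed

end

text \<open>A preimage of \<open>z\<close> is a fixed point of the contraction sending
  \<open>x\<close> to \<open>z + app Y x\<close>.\<close>

lemma endo_one_minus_bij:
  fixes Y :: "'x::banach endo"
  assumes "norm Y < 1"
  shows "bij (app (1 - Y))"
proof (rule bijI)
  show "inj (app (1 - Y))"
  proof (rule injI)
    fix x y assume "app (1 - Y) x = app (1 - Y) y"
    then have "x - y = app Y (x - y)" by (simp add: algebra_simps)
    then have "norm (x - y) \<le> norm Y * norm (x - y)" by (metis norm_app_le)
    then have "(1 - norm Y) * norm (x - y) \<le> 0" by (simp add: algebra_simps)
    then show "x = y" using assms by (simp add: mult_le_0_iff)
  qed
  show "surj (app (1 - Y))"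
  proof (rule surjI)
    fix z
    have "\<exists>!x. z + app Y x = x"
      by (rule banach_fix_type[OF norm_ge_zero assms])
        (use norm_app_le[of Y] in \<open>simp add: dist_norm flip: app_linear(2)\<close>)
    then have "\<exists>x. z + app Y x = x" by blast
    then have "z + app Y (SOME x. z + app Y x = x) = (SOME x. z + app Y x = x)" by (rule someI_ex)
    then show "app (1 - Y) (SOME x. z + app Y x = x) = z" by (simp add: algebra_simps)
  qed
qed

locale optimal_frame = frame_sequence act ip v A B
  for act :: "'x::complex_banach \<Rightarrow> 'a::cstar_algebra \<Rightarrow> 'x" and ip :: "'x \<Rightarrow> 'x \<Rightarrow> 'a"
    and v :: "nat \<Rightarrow> 'a \<Rightarrow> 'x" and A B :: real +
  assumes optimal: "\<And>A' B'. frame_bounds ip v A' B' \<Longrightarrow> A' \<le> A \<and> B \<le> B'"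
begin

text \<open>\<open>frame_bounds\<close> does not order its constants. If \<open>B < A\<close>, every
  \<open>ip x x\<close> vanishes, and then \<open>A + 1\<close> is a lower bound as well, against
  optimality.\<close>

lemma A_le_B: "A \<le> B"
proof (rule ccontr)
  assume "\<not> A \<le> B"
  then have "B < A" by simp
  have "ip x x = 0" for x
  proof -
    have "B *\<^sub>R ip x x - A *\<^sub>R ip x x \<in> cone"
      using cone_add[OF U_upper[of x] U_lower[of x]] by simp
    moreover have "(A - B) *\<^sub>R ip x x \<in> cone" using \<open>B < A\<close> by (intro cone_scaleR ip_cone) simp
    ultimately have "norm ((A - B) *\<^sub>R ip x x) \<le> norm (0::'a)"
      using cone_norm_mono[of "(A - B) *\<^sub>R ip x x" "B *\<^sub>R ip x x - A *\<^sub>R ip x x"]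
      by (simp add: algebra_simps)
    then have "norm ((A - B) *\<^sub>R ip x x) = 0" by (metis norm_ge_zero norm_zero order_antisym)
    then show ?thesis using \<open>B < A\<close> by simp
  qed
  then have "frame_bounds ip v (A + 1) B"
    using bounds by (simp add: frame_bounds_def)
  then show False using optimal by force
qed

text \<open>With \<open>P\<close> the frame operator this is one minus the root of
  \<open>P / B\<close>. Building the root from it explicitly, rather than through
  \<open>pos_sqrt\<close>, keeps control of its distance from \<open>sqrt B\<close>.\<close>

definition root_defect :: "'x endo" where
  "root_defect = sqrt_fix ((1/B) *\<^sub>R (B *\<^sub>R 1 - frame_op))"

definition frame_root :: "'x endo" where
  "frame_root = sqrt B *\<^sub>R (1 - root_defect)"

lemma frame_op_bounds:
  "norm (B *\<^sub>R 1 - frame_op) \<le> B - A" "norm (frame_op - A *\<^sub>R 1) \<le> B - A"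
proof -
  have s1: "selfadj (B *\<^sub>R 1 - frame_op)" and s2: "selfadj (frame_op - A *\<^sub>R 1)"
    by (intro adjt_diff adjt_scaleR adjt_one selfadj_frame_op)+
  show "norm (B *\<^sub>R 1 - frame_op) \<le> B - A"
    by (rule norm_le_of_ip_bounds[OF s1])
      (use A_le_B U_upper U_lower in \<open>simp_all add: ip_diff ip_scaleR ip_frame_op algebra_simps\<close>)
  show "norm (frame_op - A *\<^sub>R 1) \<le> B - A"
    by (rule norm_le_of_ip_bounds[OF s2])
      (use A_le_B U_upper U_lower in \<open>simp_all add: ip_diff ip_scaleR ip_frame_op algebra_simps\<close>)
qed

lemma root_defect:
  shows norm_root_defect: "norm root_defect \<le> 1 - sqrt (A / B)"
    and pos_root_defect: "pos root_defect"
    and frame_root_square: "frame_root * frame_root = frame_op"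
    and frame_root_commute: "\<And>z. z * frame_op = frame_op * z \<Longrightarrow> z * frame_root = frame_root * z"
proof -
  define K where "K = (1/B) *\<^sub>R (B *\<^sub>R 1 - frame_op)"
  have rd: "root_defect = sqrt_fix K" by (simp add: root_defect_def K_def)
  have AB: "0 \<le> A / B" "A / B \<le> 1" using A_pos B_pos A_le_B by (auto simp: divide_simps)
  have "norm K \<le> (1/B) * (B - A)"
    unfolding K_def norm_scaleR using B_pos frame_op_bounds(1)
    by (intro mult_mono) auto
  also have "\<dots> = 1 - A / B" using B_pos by (simp add: field_simps)
  finally have nK: "norm K \<le> 1 - A / B" .
  then have nK1: "norm K \<le> 1" using AB by linarith
  have sK: "selfadj K"
    unfolding K_def by (intro adjt_scaleR adjt_diff adjt_one selfadj_frame_op)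
  have "norm ((B - A) *\<^sub>R 1 - (B *\<^sub>R 1 - frame_op)) \<le> B - A"
    using frame_op_bounds(2) by (simp add: algebra_simps)
  moreover have "selfadj (B *\<^sub>R 1 - frame_op)"
    by (intro adjt_scaleR adjt_diff adjt_one selfadj_frame_op)
  ultimately have "pos (B *\<^sub>R 1 - frame_op)"
    unfolding pos_def using A_le_B by (intro conjI exI[of _ "B - A"]) simp_all
  then have pK: "pos K" unfolding K_def using B_pos by (intro pos_scaleR) auto
  \<comment> \<open>The value \<open>y = 1 - sqrt (A / B)\<close> gives equality when
    \<open>norm K = 1 - A / B\<close>; this is how the lower frame bound enters.\<close>
  have "norm K + (1 - sqrt (A / B))\<^sup>2 \<le> 2 * (1 - sqrt (A / B))"
    using nK AB(1) by (simp add: power2_diff)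
  then show "norm root_defect \<le> 1 - sqrt (A / B)"
    unfolding rd by (rule norm_sqrt_fix_le[rotated]) (use AB in simp)
  have sY: "selfadj root_defect" unfolding rd by (rule selfadj_sqrt_fix[OF nK1 sK])
  have eq: "2 *\<^sub>R root_defect = K + root_defect * root_defect"
    unfolding rd by (rule sqrt_fix_eq[OF nK1])
  \<comment> \<open>By the fixed point equation this is \<open>root_defect\<close> itself, so its
    positivity follows from that of \<open>K\<close> and of a square.\<close>
  have "pos ((1/2) *\<^sub>R (K + root_defect * root_defect))"
    by (rule pos_scaleR[OF pos_add[OF pK pos_square[OF sY]]]) simp
  then show "pos root_defect" by (simp flip: eq)
  have YY: "root_defect * root_defect = root_defect + root_defect - K"
    using eq by (simp add: scaleR_2 algebra_simps)
  have "frame_root * frame_root = (sqrt B * sqrt B) *\<^sub>R (1 - root_defect - root_defect + root_defect * root_defect)"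
    by (simp add: frame_root_def algebra_simps)
  also have "\<dots> = B *\<^sub>R (1 - K)" using B_pos by (simp add: YY)
  also have "\<dots> = frame_op" using B_pos by (simp add: K_def algebra_simps)
  finally show "frame_root * frame_root = frame_op" .
  fix z assume "z * frame_op = frame_op * z"
  then have "z * K = K * z" by (simp add: K_def algebra_simps)
  then have "z * root_defect = root_defect * z" unfolding rd by (rule sqrt_fix_commute[OF nK1])
  then show "z * frame_root = frame_root * z" by (simp add: frame_root_def algebra_simps)
qed

lemma pos_frame_root: "pos frame_root"
proof -
  have "0 \<le> sqrt (A / B)" using A_pos B_pos by simp
  then have "norm root_defect \<le> 1" using norm_root_defect by linarith
  then have "pos (1 *\<^sub>R 1 - root_defect)"
    by (rule pos_diff_of_norm_le[OF pos_selfadj[OF pos_root_defect]])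
  then show ?thesis unfolding frame_root_def using B_pos by (intro pos_scaleR) auto
qed

text \<open>The difference equals \<open>?d *\<^sub>R 1 - sqrt B *\<^sub>R root_defect\<close>, and
  \<open>sqrt B *\<^sub>R root_defect\<close> is positive with norm at most twice
  \<open>?d\<close>.\<close>

lemma frame_root_centre:
  "norm (frame_root - ((sqrt A + sqrt B) / 2) *\<^sub>R 1) \<le> (sqrt B - sqrt A) / 2"
proof -
  let ?d = "(sqrt B - sqrt A) / 2"
  have "pos (sqrt B *\<^sub>R root_defect)" using B_pos by (intro pos_scaleR pos_root_defect) simp
  moreover have "norm (sqrt B *\<^sub>R root_defect) \<le> sqrt B * (1 - sqrt (A / B))"
    using norm_root_defect B_pos by simp
  moreover have "sqrt B * (1 - sqrt (A / B)) = 2 * ?d"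
    using B_pos by (simp add: real_sqrt_divide right_diff_distrib)
  ultimately have "norm (?d *\<^sub>R 1 - sqrt B *\<^sub>R root_defect) \<le> ?d"
    by (intro norm_centre_diff_le) auto
  moreover have "frame_root - ((sqrt A + sqrt B) / 2) *\<^sub>R 1 = ?d *\<^sub>R 1 - sqrt B *\<^sub>R root_defect"
  proof -
    have "?d = sqrt B - (sqrt A + sqrt B) / 2" by (simp add: field_simps)
    then have "?d *\<^sub>R (1::'x endo) = sqrt B *\<^sub>R 1 - ((sqrt A + sqrt B) / 2) *\<^sub>R 1"
      by (simp only: scaleR_diff_left)
    then show ?thesis by (simp add: frame_root_def scaleR_diff_right)
  qed
  ultimately show ?thesis by simp
qed

lemma bij_frame_root: "bij (app frame_root)"
proof -
  have "0 < sqrt (A / B)" using A_pos B_pos by simp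
  then have "norm root_defect < 1" using norm_root_defect by linarith
  then have b: "bij (app (1 - root_defect))" by (rule endo_one_minus_bij)
  have "bij (\<lambda>x::'x. sqrt B *\<^sub>R x)"
    by (rule bij_betw_byWitness[where f'="\<lambda>x. (1 / sqrt B) *\<^sub>R x"]) (use B_pos in auto)
  from bij_comp[OF b this] have "bij ((\<lambda>x. sqrt B *\<^sub>R x) \<circ> app (1 - root_defect))" .
  moreover have "(\<lambda>x. sqrt B *\<^sub>R x) \<circ> app (1 - root_defect) = app frame_root"
    by (auto simp: frame_root_def)
  ultimately show ?thesis by simp
qed

lemma ip_frame_root: "ip (app frame_root x) (app frame_root y) = l2_ip (U x) (U y)"
  unfolding selfadj_app[OF pos_selfadj[OF pos_frame_root]] app_simps(4)[symmetric] frame_root_square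
  by (rule ip_frame_op)

lemma l2_norm_U: "l2_norm (U x) = norm (app frame_root x)"
  unfolding l2_norm_def norm_ip ip_frame_root by (rule refl)

lemma op_inv_sqrt_frame_op:
  "op_inv_sqrt ip (adj UNIV ip l2 l2_ip U \<circ> U) = inv (app frame_root)"
proof -
  have "op_sqrt ip (app (frame_root * frame_root)) = app frame_root"
    by (rule op_sqrt_eq[OF pos_frame_root bij_is_inj[OF bij_frame_root]])
      (simp only: frame_root_square frame_root_commute)
  then show ?thesis by (simp only: op_inv_sqrt_def frame_root_square app_frame_op)
qed

lemma norm_inv_frame_root_le:
  assumes "0 < m" "\<And>x. m * norm x \<le> l2_norm (U x)"
  shows "norm (inv (app frame_root) x) \<le> (1/m) * norm x"
  using assms(2)[of "inv (app frame_root) x"] assms(1)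
  by (simp add: l2_norm_U surj_f_inv_f[OF bij_is_surj[OF bij_frame_root]] field_simps)

lemma inv_frame_root:
  obtains R where "selfadj R" "app R = inv (app frame_root)"
    "\<And>x. app R (app frame_root x) = x" "\<And>x. app frame_root (app R x) = x"
proof -
  let ?S = "app frame_root"
  have SR: "?S (inv ?S x) = x" for x by (rule surj_f_inv_f[OF bij_is_surj[OF bij_frame_root]])
  have sym: "ip (inv ?S x) y = ip x (inv ?S y)" for x y
    using selfadj_app[OF pos_selfadj[OF pos_frame_root], of "inv ?S x" "inv ?S y"] by (simp add: SR)
  have low: "sqrt A * norm x \<le> l2_norm (U x)" for x
  proof (rule power2_le_imp_le)
    have "norm (A *\<^sub>R ip x x) \<le> norm (l2_ip (U x) (U x))"
      using A_pos by (intro cone_norm_mono_diff U_lower cone_scaleR ip_cone) simp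
    then show "(sqrt A * norm x)\<^sup>2 \<le> (l2_norm (U x))\<^sup>2"
      using A_pos by (simp add: l2_norm_square norm_ip_self power_mult_distrib)
  qed simp
  have "norm (inv ?S x) \<le> (1 / sqrt A) * norm x" for x
    by (rule norm_inv_frame_root_le[OF _ low]) (use A_pos in simp)
  then obtain R where "selfadj R" "\<And>x. app R x = inv ?S x"
    using symmetric_endo[OF sym] by blast
  then show ?thesis
    using SR inv_f_f[OF bij_is_inj[OF bij_frame_root]] by (intro that[of R]) auto
qed

text \<open>A norm estimate for \<open>U\<close> bounds \<open>frame_root\<close>, hence its square
  \<open>frame_op\<close>. Being self-adjoint, \<open>frame_op\<close> then satisfies the operator
  inequality that makes \<open>b\<^sup>2\<close> an upper frame bound.\<close>

lemma sqrt_B_le: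
  assumes b: "0 < b" and le: "\<And>x. l2_norm (U x) \<le> b * norm x"
  shows "sqrt B \<le> b"
proof -
  have "norm frame_root \<le> b" using b le by (intro norm_endo_le) (auto simp: l2_norm_U)
  then have "norm frame_root * norm frame_root \<le> b * b" using b by (intro mult_mono) auto
  then have "norm frame_op \<le> b\<^sup>2"
    using norm_mult_ineq[of frame_root frame_root] by (simp add: frame_root_square power2_eq_square)
  then have "l2_ip (U x) (U x) \<sqsubseteq> b\<^sup>2 *\<^sub>R ip x x" for x
    using bounded_by_norm[OF selfadj_frame_op] by (simp add: ip_frame_op cstar_le_def)
  then have "frame_bounds ip v A (b\<^sup>2)"
    using bounds b by (simp add: frame_bounds_def l2_ip_def analysis_def)
  then have "B \<le> b\<^sup>2" using optimal by blast
  then show ?thesis using b by (simp add: real_le_lsqrt)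
qed

text \<open>The dual argument through the inverse root \<open>R\<close>: the norm bound on
  \<open>R * R\<close> becomes an operator inequality, which is evaluated at
  \<open>app frame_root x\<close>.\<close>

lemma le_sqrt_A:
  assumes m: "0 < m" and le: "\<And>x. m * norm x \<le> l2_norm (U x)"
  shows "m \<le> sqrt A"
proof -
  obtain R where R: "selfadj R" "app R = inv (app frame_root)"
    "\<And>x. app R (app frame_root x) = x" "\<And>x. app frame_root (app R x) = x"
    by (rule inv_frame_root) blast
  have "norm R \<le> 1/m"
    using m norm_inv_frame_root_le[OF m le] by (intro norm_endo_le) (auto simp: R(2))
  then have "norm R * norm R \<le> (1/m) * (1/m)" using m by (intro mult_mono) auto
  then have n: "norm (R * R) \<le> (1/m) * (1/m)" using norm_mult_ineq[of R R] by linarith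
  have "m\<^sup>2 *\<^sub>R ip x x \<sqsubseteq> l2_ip (U x) (U x)" for x
  proof -
    let ?y = "app frame_root x"
    have "positive (((1/m) * (1/m)) *\<^sub>R ip ?y ?y - ip ?y (app (R * R) ?y))"
      by (rule bounded_by_norm[OF adjt_mult[OF R(1) R(1)] n])
    moreover have "ip ?y (app (R * R) ?y) = ip x x" 
      by (simp add: R(3) flip: selfadj_app[OF R(1)])
    ultimately have "positive (((1/m) * (1/m)) *\<^sub>R l2_ip (U x) (U x) - ip x x)"
      by (simp only: ip_frame_root)
    then obtain b where b: "((1/m) * (1/m)) *\<^sub>R l2_ip (U x) (U x) - ip x x = star b * b"
      by (auto simp: positive_def)
    \<comment> \<open>Multiplying by \<open>m * m\<close> turns the witness \<open>b\<close> of
      positivity into \<open>m *\<^sub>R b\<close>.\<close>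
    have "l2_ip (U x) (U x) - m\<^sup>2 *\<^sub>R ip x x = (m * m) *\<^sub>R (((1/m) * (1/m)) *\<^sub>R l2_ip (U x) (U x) - ip x x)"
      using m by (simp add: algebra_simps power2_eq_square)
    also have "\<dots> = star (m *\<^sub>R b) * (m *\<^sub>R b)" unfolding b by (simp add: star_scaleR)
    finally show ?thesis unfolding cstar_le_def positive_def by blast
  qed
  then have "frame_bounds ip v (m\<^sup>2) B"
    using bounds m by (simp add: frame_bounds_def l2_ip_def analysis_def)
  then have "m\<^sup>2 \<le> A" using optimal by blast
  then show ?thesis using m by (simp add: real_le_rsqrt)
qed

end

section \<open>The distance to the tight frames\<close>

lemma op_norm_le:
  assumes "\<And>x. norm x \<le> 1 \<Longrightarrow> l2_norm (T x) \<le> d"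
  shows "op_norm T \<le> d"
  unfolding op_norm_def by (rule cSUP_least) (use assms in \<open>auto intro!: exI[of _ 0]\<close>)

text \<open>The crude constant \<open>C\<close> only ensures that the supremum is taken over a
  bounded set; homogeneity then carries the bound from unit vectors to all.\<close>

lemma l2_norm_le_op_norm:
  assumes bd: "\<And>x. l2_norm (T x) \<le> C * norm x" and l2: "\<And>x. T x \<in> l2"
    and hom: "\<And>r x. T (r *\<^sub>R x) = (\<lambda>n. r *\<^sub>R T x n)"
  shows "l2_norm (T x) \<le> op_norm T * norm x"
proof (cases "x = 0")
  case True
  then show ?thesis using bd[of 0] by simp
next
  case False
  have "bdd_above ((\<lambda>x. l2_norm (T x)) ` {x. norm x \<le> 1})"
  proof (rule bdd_aboveI2)
    fix x :: 'a assume "x \<in> {x. norm x \<le> 1}"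
    then have "\<bar>C\<bar> * norm x \<le> \<bar>C\<bar> * 1" by (intro mult_left_mono) auto
    moreover have "C * norm x \<le> \<bar>C\<bar> * norm x" by (intro mult_right_mono) auto
    ultimately show "l2_norm (T x) \<le> \<bar>C\<bar>" using bd[of x] by linarith
  qed
  then have "l2_norm (T ((1 / norm x) *\<^sub>R x)) \<le> op_norm T"
    unfolding op_norm_def by (rule cSUP_upper[rotated]) (use False in simp)
  then show ?thesis using False by (simp add: hom l2_norm_scaleR[OF l2] field_simps)
qed

theorem proposition5p9:
  fixes act :: "'x::complex_banach \<Rightarrow> 'a::cstar_algebra \<Rightarrow> 'x"
    and ip :: "'x \<Rightarrow> 'x \<Rightarrow> 'a"
    and xs :: "nat \<Rightarrow> 'a \<Rightarrow> 'x"
    and U V\<^sub>0 :: "'x \<Rightarrow> nat \<Rightarrow> 'a"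
    and A B c :: real
  assumes "hilbert_module act ip"
    and "frame act ip xs \<or> outer_frame act ip xs"
    and "U = analysis ip xs"
    and "optimal_frame_bounds ip xs A B"
    and "c = (sqrt A + sqrt B) / 2"
    and "V\<^sub>0 = (\<lambda>x n. c *\<^sub>R U (op_inv_sqrt ip (adj UNIV ip l2 l2_ip U \<circ> U) x) n)"
  shows "(\<exists>ws. (frame act ip ws \<or> outer_frame act ip ws) \<and> tight ip (c\<^sup>2) ws \<and>
           V\<^sub>0 = analysis ip ws) \<and>
         op_norm (\<lambda>x n. U x n - V\<^sub>0 x n) = (sqrt B - sqrt A) / 2 \<and>
         (\<forall>ys c' V. (frame act ip ys \<or> outer_frame act ip ys) \<and> tight ip c' ys \<and>
           V = analysis ip ys \<longrightarrow>
           (sqrt B - sqrt A) / 2 \<le> op_norm (\<lambda>x n. U x n - V x n))"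
proof -
  interpret hilbert_module act ip by (rule assms(1))
  have mem: "xs n \<in> multiplier_module ip" for n
    using assms(2) unfolding frame_or_outer_frame_iff by blast
  interpret X: optimal_frame act ip xs A B
    by unfold_locales (use mem assms(4) in \<open>auto simp: optimal_frame_bounds_def\<close>)
  have U: "U = X.U" by (rule assms(3))
  let ?S = "app X.frame_root"
  have c: "0 < c" using X.A_pos X.B_pos by (simp add: assms(5) add_pos_pos)
  obtain R where R: "selfadj R" "app R = inv ?S" "\<And>x. app R (?S x) = x" "\<And>x. ?S (app R x) = x"
    by (rule X.inv_frame_root) blast
  have V0: "V\<^sub>0 x = (\<lambda>n. c *\<^sub>R U (app R x) n)" for x
    by (simp add: assms(6) U X.op_inv_sqrt_frame_op R(2))

  \<comment> \<open>Distance from \<open>U\<close> to an arbitrary tight frame\<close>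
  have lower: "(sqrt B - sqrt A) / 2 \<le> op_norm (\<lambda>x n. U x n - V x n)"
    if ys: "frame act ip ys \<or> outer_frame act ip ys" and t: "tight ip c' ys"
      and V: "V = analysis ip ys" for ys c' V
  proof -
    interpret Y: frame_sequence act ip ys c' c'
      by unfold_locales (use ys t in \<open>auto simp: frame_or_outer_frame_iff tight_def\<close>)
    let ?T = "\<lambda>x n. U x n - V x n"
    let ?\<delta> = "op_norm ?T"
    have UV: "U x \<in> l2" "V x \<in> l2" for x by (simp_all add: U V X.U_l2 Y.U_l2)
    have Vn: "l2_norm (V x) = sqrt c' * norm x" for x
    proof -
      have 1: "l2_ip (V x) (V x) - c' *\<^sub>R ip x x \<in> cone" and 2: "c' *\<^sub>R ip x x - l2_ip (V x) (V x) \<in> cone"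
        unfolding V by (rule Y.U_lower Y.U_upper)+
      \<comment> \<open>The difference and its negative both lie in the cone, so monotonicity of the
        norm makes it vanish.\<close>
      have "norm (l2_ip (V x) (V x) - c' *\<^sub>R ip x x) \<le> norm (0::'a)"
        using cone_norm_mono[OF 1 2] by simp
      then have "l2_ip (V x) (V x) = c' *\<^sub>R ip x x" by simp
      then show ?thesis using Y.A_pos by (simp add: l2_norm_def norm_ip real_sqrt_mult)
    qed
    have Tn: "l2_norm (?T x) \<le> ?\<delta> * norm x" for x
    proof (rule l2_norm_le_op_norm)
      show "?T x \<in> l2" for x by (rule l2_diff[OF UV])
      show "?T (r *\<^sub>R x) = (\<lambda>n. r *\<^sub>R ?T x n)" for r x
        by (simp add: U V X.U_scaleR Y.U_scaleR scaleR_diff_right)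
      have "(\<lambda>n. - V x n) \<in> l2" for x using l2_scaleR(1)[OF UV(2), of "-1"] by simp
      from l2_norm_triangle[OF UV(1) this]
      have "l2_norm (?T x) \<le> l2_norm (U x) + l2_norm (\<lambda>n. - V x n)" for x by simp
      moreover have "l2_norm (\<lambda>n. - V x n) = l2_norm (V x)" for x
        using l2_norm_scaleR[OF UV(2), of "-1"] by simp
      ultimately show "l2_norm (?T x) \<le> (sqrt B + sqrt c') * norm x" for x
        using X.U_norm[of x] by (simp add: Vn U distrib_right) (metis add_right_mono order_trans)
    qed
    have up: "l2_norm (U x) \<le> (sqrt c' + ?\<delta>) * norm x" for x
      using l2_norm_triangle_diff(1)[OF UV, of x x] Tn[of x] by (simp add: Vn distrib_right)
    have low: "(sqrt c' - ?\<delta>) * norm x \<le> l2_norm (U x)" for x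
      using l2_norm_triangle_diff(2)[OF UV, of x x] Tn[of x] by (simp add: Vn left_diff_distrib)
    \<comment> \<open>Cancelling \<open>norm x\<close> requires a nonzero vector; on the zero module
      \<open>A + 1\<close> would be a lower bound too, against optimality.\<close>
    have "0 \<le> ?\<delta>"
    proof -
      have "\<exists>x::'x. x \<noteq> 0"
      proof (rule ccontr)
        assume "\<not> (\<exists>x::'x. x \<noteq> 0)"
        then have "ip x x = 0" for x by (metis ip_zero(1))
        then have "frame_bounds ip xs (A + 1) B"
          using X.bounds by (simp add: frame_bounds_def)
        then show False using X.optimal by force
      qed
      then obtain x :: 'x where "x \<noteq> 0" by blast
      have "0 \<le> ?\<delta> * norm x" by (rule order_trans[OF l2_norm_nonneg Tn])
      with \<open>x \<noteq> 0\<close> show ?thesis by (simp add: zero_le_mult_iff)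
    qed
    have c': "0 < sqrt c'" using Y.A_pos by simp
    have "sqrt B \<le> sqrt c' + ?\<delta>"
      by (rule X.sqrt_B_le[OF add_pos_nonneg[OF c' \<open>0 \<le> ?\<delta>\<close>]]) (simp only: U[symmetric] up)
    moreover have "sqrt c' - ?\<delta> \<le> sqrt A"
    \<comment> \<open>\<open>le_sqrt_A\<close> applies to positive constants only; a constant that
      is not positive lies below \<open>sqrt A\<close> anyway.\<close>
    proof (cases "0 < sqrt c' - ?\<delta>")
      case True
      then show ?thesis by (rule X.le_sqrt_A) (simp only: U[symmetric] low)
    next
      case False
      then show ?thesis using X.A_pos by (meson not_less order_trans real_sqrt_ge_zero less_imp_le)
    qed
    ultimately show ?thesis by simp
  qed

  \<comment> \<open>The tight frame with analysis operator \<open>V\<^sub>0\<close>\<close>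
  define ws where "ws n a = c *\<^sub>R app R (xs n a)" for n a
  \<comment> \<open>As \<open>R\<close> is self-adjoint, applying \<open>c *\<^sub>R R\<close> to
    the frame members amounts to applying it to \<open>x\<close> before the analysis
    operator.\<close>
  have ws_adjoint: "ip (ws n a) x = star a * (c *\<^sub>R mult_ip ip (xs n) (app R x))" for n a x
    by (simp add: ws_def ip_scaleR selfadj_app[OF R(1)] mult_ip_adjoint[OF mem])
  have ws_mem: "ws n \<in> multiplier_module ip" for n
    unfolding multiplier_module_def adjointable_def is_adjoint_def alg_ip_def
    using ws_adjoint by fast
  have an: "V\<^sub>0 = analysis ip ws"
  proof -
    have "mult_ip ip (ws n) x = c *\<^sub>R mult_ip ip (xs n) (app R x)" for n x
      by (rule mult_ip_eqI[OF ws_mem ws_adjoint])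
    then show ?thesis by (intro ext) (simp add: V0 U analysis_def)
  qed
  \<comment> \<open>By \<open>ip_frame_root\<close> the sequence inner product of
    \<open>U (app R x)\<close> with itself is that of \<open>?S (app R x) = x\<close> in the
    module.\<close>
  have V0_ip: "V\<^sub>0 x \<in> l2" "l2_ip (V\<^sub>0 x) (V\<^sub>0 x) = c\<^sup>2 *\<^sub>R ip x x" for x
    unfolding V0 U using l2_scaleR[OF X.U_l2, of c "app R x"]
    by (simp_all add: R(4) flip: X.ip_frame_root)
  have tight: "tight ip (c\<^sup>2) ws"
    unfolding tight_def frame_bounds_def
  proof (intro conjI allI)
    fix x
    have eq: "(\<lambda>n. star (mult_ip ip (ws n) x) * mult_ip ip (ws n) x) = (\<lambda>n. star (V\<^sub>0 x n) * V\<^sub>0 x n)"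
      by (simp add: an analysis_def)
    show "summable (\<lambda>n. star (mult_ip ip (ws n) x) * mult_ip ip (ws n) x)"
      unfolding eq by (rule l2_summable[OF V0_ip(1)])
    have "positive (0::'a)" by (auto simp: positive_def intro!: exI[of _ 0])
    then show "c\<^sup>2 *\<^sub>R ip x x \<sqsubseteq> (\<Sum>n. star (mult_ip ip (ws n) x) * mult_ip ip (ws n) x)"
      and "(\<Sum>n. star (mult_ip ip (ws n) x) * mult_ip ip (ws n) x) \<sqsubseteq> c\<^sup>2 *\<^sub>R ip x x"
      unfolding eq using V0_ip(2)[of x] by (simp_all add: l2_ip_def cstar_le_def)
  qed (use c in simp_all)
  have ws_frame: "frame act ip ws \<or> outer_frame act ip ws"
    unfolding frame_or_outer_frame_iff using ws_mem tight by (auto simp: tight_def)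

  \<comment> \<open>Distance from \<open>U\<close> to \<open>V\<^sub>0\<close>\<close>
  have "op_norm (\<lambda>x n. U x n - V\<^sub>0 x n) \<le> (sqrt B - sqrt A) / 2"
  proof (rule op_norm_le)
    fix x :: 'x assume x: "norm x \<le> 1"
    let ?d = "(sqrt B - sqrt A) / 2"
    let ?D = "X.frame_root - c *\<^sub>R 1"
    \<comment> \<open>Factoring out \<open>U\<close> leaves \<open>x - c *\<^sub>R app R x\<close>;
      by \<open>l2_norm_U\<close> the norm can be measured after \<open>?S\<close>, which gives the
      deviation of the root from \<open>c\<close>.\<close>
    have "(\<lambda>n. U x n - V\<^sub>0 x n) = X.U (x - c *\<^sub>R app R x)"
      unfolding V0 U X.U_diff X.U_scaleR by (rule refl)
    moreover have "?S (x - c *\<^sub>R app R x) = app ?D x" by (simp add: R(4))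
    ultimately have "l2_norm (\<lambda>n. U x n - V\<^sub>0 x n) = norm (app ?D x)" by (simp only: X.l2_norm_U)
    also have "\<dots> \<le> norm ?D * norm x" by (rule norm_app_le)
    also have "\<dots> \<le> ?d * 1"
      using X.frame_root_centre X.A_le_B x unfolding assms(5) by (intro mult_mono) auto
    finally show "l2_norm (\<lambda>n. U x n - V\<^sub>0 x n) \<le> ?d" by simp
  qed
  moreover have "(sqrt B - sqrt A) / 2 \<le> op_norm (\<lambda>x n. U x n - V\<^sub>0 x n)"
    by (rule lower[OF ws_frame tight an])
  ultimately show ?thesis using lower ws_frame tight an by (auto intro: antisym)
qed

end
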